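(* Let $p$ be a prime, $q=p^r$ with $r\ge1$, $n\ge 1$ an integer, and let $f(x),g(x),h(x)\in\mathbf{F}_q[x]$ be monic polynomials of degree less than $n$ such that $f(x)$ and $g(x)$ divide $x^n-1$. Assume that $f(x)\mid g(x)\mid g^\perp(x)\mid f^\perp(x)$. Then the quasi-cyclic code $Q=Q_q(f,g,h)\subset\mathbf{F}_q^{2n}$ is self-orthogonal for the Euclidean inner product in the sense that $Q^\perp\subset Q$, and there exists a stabilizer quantum code with parameters $$[[2n,\ 2n-2\deg(f(x))-2\deg(g(x)),\ \ge d_q^e(f,g,h)]]_q,$$ where $$d_q^e(f,g,h)=\min\Big\{ d([g]),\ d\big([(x^n-1)/\gcd(x^n-1,h)]\big),\ d\big([\mathrm{lcm}(f,\,g/\gcd(g,h))]\big),\ d([f])+d([\gcd(hf,g)])\Big\}.$$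
   Context: Classical notation. $R=\mathbf{F}_q[x]/(x^n-1)$ and $[a(x)]$ is the class of $a(x)$ in $R$. A vector $(a_0,\ldots,a_{n-1})\in\mathbf{F}_q^n$ is identified with $[a_0+a_1x+\cdots+a_{n-1}x^{n-1}]\in R$, and $\mathbf{F}_q^{2n}$ is identified with $R^2$ accordingly (first $n$ coordinates, last $n$ coordinates). $Q_q(f,g,h)$ is the $R$-submodule of $R^2$ generated by $([f(x)],[h(x)f(x)])$ and $(0,[g(x)])$. For a divisor $f(x)$ of $x^n-1$, let $f'(x)$ be defined by $f(x)f'(x)=x^n-1$ and put $f^\perp(x)=x^{\deg f'}f'(1/x)$; similarly for $g^\perp$. $d([u(x)])$ is the minimum Hamming distance of the cyclic code (ideal of $R$) generated by $[u(x)]$, i.e. the minimum Hamming weight of its nonzero elements, with the convention that it is $+\infty$ if this code is zero. $Q^\perp$ is the dual of $Q$ for the standard (Euclidean) inner product on $\mathbf{F}_q^{2n}$. Quantum codes. Let $\mathbf{C}^q$ have orthonormal basis $|u\rangle$, $u\in\mathbf{F}_q$, let $\omega=e^{2\pi i/p}$, let $\mathrm{tr}:\mathbf{F}_q\to\mathbf{F}_p$ be the trace, and put $X(a)|u\rangle=|u+a\rangle$, $Z(b)|u\rangle=\omega^{\mathrm{tr}(bu)}|u\rangle$ for $a,b\in\mathbf{F}_q$. The error group on $\mathbf{C}^{q^N}=(\mathbf{C}^q)^{\otimes N}$ consists of the operators $\omega^c\,X(a_1)Z(b_1)\otimes\cdots\otimes X(a_N)Z(b_N)$ with $c\in\mathbf{F}_p$,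 $a_i,b_i\in\mathbf{F}_q$; the weight of such an operator is the number of $i$ with $(a_i,b_i)\ne(0,0)$. A stabilizer code of length $N$ is a nonzero common eigenspace $\mathcal C$ of a commutative subgroup $S$ of the error group, i.e. $\mathcal C=\{v\mid Ev=\chi(E)v\ \forall E\in S\}$ for some character $\chi$ of $S$. It has parameters $[[N,k,\ge d]]_q$ if $\dim_{\mathbf C}\mathcal C=q^k$ and every error $E$ of weight less than $d$ is detectable or has no effect on $\mathcal C$, i.e. $PEP=c_EP$ for some scalar $c_E$, where $P$ is the orthogonal projector onto $\mathcal C$. *)

theory Defs
  imports
    "HOL-Analysis.Analysis"
    "HOL-Computational_Algebra.Computational_Algebra"
    "HOL-Algebra.Group"
begin

section \<open>Classical quasi-cyclic codes\<close>

text \<open>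
  An element of \<open>R = F[x]/(x^n - 1)\<close> is represented by the list of the \<open>n\<close> coefficients of the
  reduced representative of the class, which is also its identification with a vector of \<open>F^n\<close>.
  Vectors of \<open>F^N\<close> are lists of length \<open>N\<close>, so \<open>R \<times> R\<close> becomes \<open>F^(2n)\<close> by appending lists.
\<close>

definition cyc_modulus :: "nat \<Rightarrow> 'a::field poly" where
  "cyc_modulus n = monom 1 n - 1"

definition residue_vec :: "nat \<Rightarrow> 'a::field poly \<Rightarrow> 'a list" where
  "residue_vec n a = map (coeff (a mod cyc_modulus n)) [0..<n]"

definition hamming_weight :: "'a::zero list \<Rightarrow> nat" where
  "hamming_weight v = length (filter (\<lambda>x. x \<noteq> 0) v)"

definition cyclic_code :: "nat \<Rightarrow> 'a::field poly \<Rightarrow> 'a list set" where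
  "cyclic_code n u = {residue_vec n (c * u) | c. True}"

text \<open>The infimum of the empty set is \<open>\<infinity>\<close> in \<^typ>\<open>enat\<close>: this is the value for the zero code.\<close>

definition cyclic_dist :: "nat \<Rightarrow> 'a::field poly \<Rightarrow> enat" where
  "cyclic_dist n u =
     (INF v \<in> cyclic_code n u - {replicate n 0}. enat (hamming_weight v))"

text \<open>
  The linear combinations \<open>c ([f], [h f]) + e (0, [g])\<close> with coefficients \<open>[c]\<close>, \<open>[e]\<close> in \<open>R\<close>.
\<close>

definition quasi_cyclic_code ::
    "nat \<Rightarrow> 'a::field poly \<Rightarrow> 'a poly \<Rightarrow> 'a poly \<Rightarrow> 'a list set" where
  "quasi_cyclic_code n f g h =
     {residue_vec n (c * f) @ residue_vec n (c * (h * f) + e * g) | c e. True}"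

definition euclidean_dual :: "nat \<Rightarrow> 'a::comm_semiring_1 list set \<Rightarrow> 'a list set" where
  "euclidean_dual N C =
     {v. length v = N \<and> (\<forall>w\<in>C. sum_list (map2 (*) v w) = 0)}"

text \<open>\<^const>\<open>reflect_poly\<close> maps \<open>u\<close> to \<open>x^(deg u) u(1/x)\<close>.\<close>

definition perp_poly :: "nat \<Rightarrow> 'a::field poly \<Rightarrow> 'a poly" where
  "perp_poly n f = reflect_poly (cyc_modulus n div f)"

definition dist_bound ::
    "nat \<Rightarrow> 'a::field_gcd poly \<Rightarrow> 'a poly \<Rightarrow> 'a poly \<Rightarrow> enat" where
  "dist_bound n f g h = Min
     {cyclic_dist n g,
      cyclic_dist n (cyc_modulus n div gcd (cyc_modulus n) h),
      cyclic_dist n (lcm f (g div gcd g h)),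
      cyclic_dist n f + cyclic_dist n (gcd (h * f) g)}"

section \<open>Stabilizer codes\<close>

text \<open>
  The index type \<open>'a\<close> is the field with \<open>q = p ^ r\<close> elements, and \<open>'m\<close> is the set of tensor factors,
  so that the length is \<open>CARD('m)\<close>. The space \<open>('a ^ 'm) cvec\<close> is the tensor power of
  \<open>'a cvec\<close>, its coordinate vector at \<open>u :: 'a ^ 'm\<close> being the tensor product of the basis
  vectors at \<open>u $ i\<close>. In a matrix entry \<open>M $ v $ u\<close> the output index \<open>v\<close> comes first.
\<close>

type_synonym 'k cvec = "(complex, 'k) vec"
type_synonym 'k cmat = "((complex, 'k) vec, 'k) vec"

definition omega :: "nat \<Rightarrow> complex" where
  "omega p = exp (2 * of_real pi * \<i> / of_nat p)"

text \<open>The trace to the prime field; its values lie in the range of \<^const>\<open>of_nat\<close>.\<close>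

definition field_trace :: "nat \<Rightarrow> nat \<Rightarrow> 'a::field \<Rightarrow> 'a" where
  "field_trace p r x = (\<Sum>i<r. x ^ (p ^ i))"

text \<open>
  The exponent in \<open>omega p ^ tr(x)\<close> is a natural number representing the trace; the choice is
  irrelevant since \<open>omega p\<close> has order \<open>p\<close>.
\<close>

definition trace_char :: "nat \<Rightarrow> nat \<Rightarrow> 'a::field \<Rightarrow> complex" where
  "trace_char p r x = omega p ^ (LEAST k. of_nat k = field_trace p r x)"

definition shift_X :: "'a::{field,finite} \<Rightarrow> 'a cmat" where
  "shift_X a = (\<chi> v u. if v = u + a then 1 else 0)"

definition phase_Z :: "nat \<Rightarrow> nat \<Rightarrow> 'a::{field,finite} \<Rightarrow> 'a cmat" where
  "phase_Z p r b = (\<chi> v u. if v = u then trace_char p r (b * u) else 0)"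

definition tensor_op ::
    "('m::finite \<Rightarrow> 'a::finite cmat) \<Rightarrow> ('a ^ 'm) cmat" where
  "tensor_op M = (\<chi> v u. \<Prod>i\<in>UNIV. M i $ (v $ i) $ (u $ i))"

definition error_op ::
    "nat \<Rightarrow> nat \<Rightarrow> nat \<Rightarrow> 'a::{field,finite} ^ 'm::finite \<Rightarrow> 'a ^ 'm
      \<Rightarrow> ('a ^ 'm) cmat" where
  "error_op p r c a b =
     map_matrix ((*) (omega p ^ c)) (tensor_op (\<lambda>i. shift_X (a $ i) ** phase_Z p r (b $ i)))"

definition error_weight :: "'a::zero ^ 'm::finite \<Rightarrow> 'a ^ 'm \<Rightarrow> nat" where
  "error_weight a b = card {i. (a $ i, b $ i) \<noteq> (0, 0)}"

definition error_group ::
    "nat \<Rightarrow> nat \<Rightarrow> ('a::{field,finite} ^ 'm::finite) cmat monoid" where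
  "error_group p r =
     \<lparr>carrier = {error_op p r c a b | c a b. c < p}, mult = (**), one = mat 1\<rparr>"

definition stabilizer_code ::
    "nat \<Rightarrow> nat \<Rightarrow> ('a::{field,finite} ^ 'm::finite) cvec set \<Rightarrow> bool" where
  "stabilizer_code p r C \<longleftrightarrow>
     C \<noteq> {0} \<and>
     (\<exists>S ch. subgroup S (error_group p r) \<and>
        (\<forall>E\<in>S. \<forall>F\<in>S. E ** F = F ** E) \<and>
        (\<forall>E\<in>S. ch E \<noteq> 0) \<and> (\<forall>E\<in>S. \<forall>F\<in>S. ch (E ** F) = ch E * ch F) \<and>
        C = {v. \<forall>E\<in>S. E *v v = ch E *s v})"

definition orth_projector :: "'k::finite cmat \<Rightarrow> 'k cvec set \<Rightarrow> bool" where
  "orth_projector P C \<longleftrightarrow>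
     P ** P = P \<and> map_matrix cnj (transpose P) = P \<and> range ((*v) P) = C"

text \<open>
  The parameters \<open>[[N, k, \<ge> d]]\<close>. Every element of the error group determines its \<open>a\<close> and \<open>b\<close>.
\<close>

definition has_parameters ::
    "nat \<Rightarrow> nat \<Rightarrow> ('a::{field,finite} ^ 'm::finite) cvec set
      \<Rightarrow> nat \<Rightarrow> int \<Rightarrow> enat \<Rightarrow> bool" where
  "has_parameters p r C N k d \<longleftrightarrow>
     CARD('m) = N \<and>
     real (vec.dim C) = real CARD('a) powi k \<and>
     (\<exists>P. orth_projector P C \<and>
        (\<forall>c a b. c < p \<and> enat (error_weight a b) < d \<longrightarrow>
           (\<exists>s. P ** error_op p r c a b ** P = map_matrix ((*) s) P)))"

end

theory Submission
  imports Defs "HOL-Number_Theory.Cong"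
begin

no_notation fps_nth (infixl "$" 75)

text \<open>
  Let \<open>D = Q\<^sup>\<bottom>\<close>. For \<open>(u, v) \<in> D\<close> write \<open>u\<^sup>*, v\<^sup>*\<close> for the polynomials with reversed coefficients: the inner
  product of \<open>v\<close> with a class \<open>[b]\<close> is the top coefficient of \<open>v\<^sup>* b\<close> modulo \<open>x^n - 1\<close>. Testing against
  all multiples of the two generators of \<open>Q\<close>, which include all cyclic shifts, shows that \<open>x^n - 1\<close>
  divides \<open>v\<^sup>* g\<close> and \<open>(u\<^sup>* + v\<^sup>* h) f\<close>, hence also \<open>u\<^sup>* g\<close>. Reflecting back, \<open>g\<^sup>\<bottom>\<close> and thus \<open>g\<close>
  divides \<open>u\<close> and \<open>v\<close>, so that \<open>(u, v) \<in> Q\<close>.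

  The quantum code is the CSS code of \<open>D \<subseteq> Q\<close>: its stabilizer consists of the \<open>X(a) Z(b)\<close> with
  \<open>a, b \<in> D\<close>, and it is the space of functions supported on \<open>Q = D\<^sup>\<bottom>\<close> and constant on the cosets of
  \<open>D\<close>, of dimension \<open>|Q| / |D| = |Q|\<^sup>2 / q^(2n)\<close>. An error \<open>X(a) Z(b)\<close> with \<open>a \<notin> Q\<close> or \<open>b \<notin> Q\<close> fails to
  commute with some stabilizer element and is killed by the projector on both sides; if \<open>a, b \<in> Q\<close>
  and the weight is below the distance of \<open>Q\<close>, the error is a scalar. The terms of the bound other
  than the second one estimate the weight of a word \<open>(u, v) \<in> Q\<close> according to which of \<open>u\<close>, \<open>v\<close> vanish.
\<close>

section \<open>The additive character of a finite field\<close>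

text \<open>Multiplication by a nonzero \<open>x\<close> permutes the nonzero elements, so comparing
  the products of all of them gives \<open>x ^ (q - 1) = 1\<close>.\<close>

lemma finite_field_power_card:
  fixes x :: "'a::{field,finite}"
  shows "x ^ CARD('a) = x"
proof (cases "x = 0")
  case False
  have "(\<Prod>y\<in>UNIV-{0}. y) = (\<Prod>y\<in>UNIV-{0}. x * y)"
    by (rule prod.reindex_bij_witness[of _ "\<lambda>y. x * y" "\<lambda>y. y / x"]) (use False in auto)
  also have "\<dots> = x ^ (CARD('a) - 1) * (\<Prod>y\<in>UNIV-{0}. y)"
    by (simp add: prod.distrib)
  finally have "x ^ (CARD('a) - 1) = 1"
    by simp
  then show ?thesis
    using power_minus_mult[of "CARD('a)" x] by simp
qed simp

text \<open>The parameter \<open>F\<close> makes the field type visible, so that an interpretation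
  can select it by \<open>TYPE('a)\<close>.\<close>

locale finite_field_trace =
  fixes p r :: nat and F :: "'a::{field,finite} itself"
  assumes prime_p: "prime p" and card_field: "CARD('a) = p ^ r"
begin

abbreviation tr :: "'a \<Rightarrow> 'a" where "tr \<equiv> field_trace p r"
abbreviation ch :: "'a \<Rightarrow> complex" where "ch \<equiv> trace_char p r"

lemma r_pos: "r > 0"
proof (rule ccontr)
  assume "\<not> r > 0"
  then have "CARD('a) = 1" using card_field by simp
  then obtain y :: 'a where "UNIV = {y}" by (rule card_1_singletonE)
  then have "(0::'a) = 1" by (metis UNIV_I singletonD)
  then show False by simp
qed

text \<open>Translation by 1 permutes the field, so the sum of all elements is unchanged when
  \<open>q\<close> is added to it. Hence \<open>p ^ r\<close> vanishes in the field, and so does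
  \<open>p\<close>.\<close>

lemma of_nat_p: "of_nat p = (0::'a)"
proof -
  have "(\<Sum>u\<in>UNIV. u) = (\<Sum>u\<in>UNIV. u + (1::'a))"
    by (rule sum.reindex_bij_witness[of _ "\<lambda>u. u + 1" "\<lambda>u. u - 1"]) auto
  then have "of_nat (CARD('a)) = (0::'a)"
    by (simp add: sum.distrib)
  then show ?thesis
    using card_field by simp
qed

lemma CHAR_p: "CHAR('a) = p"
proof -
  have "CHAR('a) dvd p" using of_nat_p of_nat_eq_0_iff_char_dvd by blast
  then show ?thesis
    using prime_p CHAR_not_1' by (metis One_nat_def prime_nat_iff)
qed

lemma tr_add: "tr (x + y) = tr x + tr y"
proof -
  have "(x + y) ^ (p ^ i) = x ^ (p ^ i) + y ^ (p ^ i)" for i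
    using prime_p CHAR_p by (intro freshmans_dream') auto
  then show ?thesis
    by (simp add: field_trace_def sum.distrib)
qed

text \<open>Frobenius shifts the summands of the trace cyclically, because
  \<open>x ^ (p ^ r) = x\<close>.\<close>

lemma tr_power_p: "tr x ^ p = tr x"
proof -
  have "tr x ^ p = (\<Sum>i<r. x ^ (p ^ Suc i))"
    unfolding field_trace_def using prime_p CHAR_p
    by (subst freshmans_dream_sum) (auto simp: mult.commute simp flip: power_mult)
  \<comment> \<open>Both sides are the sum of \<open>x ^ p ^ i\<close> over
    \<open>i \<le> r\<close>, split off at its first and at its last term.\<close>
  also have "\<dots> + x ^ p ^ 0 = (\<Sum>i<r. x ^ (p ^ i)) + x ^ p ^ r"
    using sum.lessThan_Suc_shift[of "\<lambda>i. x ^ p ^ i" r] sum.lessThan_Suc[of "\<lambda>i. x ^ p ^ i" r]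
    by (simp only: add.commute)
  also have "x ^ p ^ r = x"
    using finite_field_power_card[of x] card_field by simp
  finally show ?thesis
    by (simp add: field_trace_def)
qed

lemma of_nat_inj: "inj_on (of_nat :: nat \<Rightarrow> 'a) {..<p}"
  by (rule inj_onI)
    (use CHAR_p of_nat_eq_iff_cong_CHAR[where 'a='a] in \<open>auto simp: cong_def\<close>)

text \<open>The trace is a root of \<open>y ^ p - y\<close>. This polynomial has at most
  \<open>p\<close> roots, and the images of \<open>0, ..., p - 1\<close> already exhaust
  them.\<close>

lemma tr_of_nat: "\<exists>k. of_nat k = tr x"
proof -
  define P :: "'a poly" where "P = monom 1 p - monom 1 1"
  have p1: "p > 1" using prime_p prime_gt_1_nat by blast
  have deg: "degree P = p"
    unfolding P_def diff_conv_add_uminus using p1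
    by (subst degree_add_eq_left) (auto simp: degree_monom_eq)
  have P0: "P \<noteq> 0" using deg p1 by auto
  have root: "poly P y = 0 \<longleftrightarrow> y ^ p = y" for y
    by (simp add: P_def poly_monom)
  have "of_nat ` {..<p} \<subseteq> {y. poly P y = 0}"
  proof -
    \<comment> \<open>Fermat's little theorem, by induction from the additivity of the
      \<open>p\<close>-th power.\<close>
    have "of_nat k ^ p = (of_nat k :: 'a)" for k
    proof (induction k)
      case (Suc k)
      have "(1 + of_nat k :: 'a) ^ p = 1 ^ p + of_nat k ^ p"
        using prime_p CHAR_p by (intro freshmans_dream) auto
      then show ?case using Suc by simp
    qed (use p1 in simp)
    then show ?thesis using root by auto
  qed
  moreover have "card {y. poly P y = 0} \<le> card (of_nat ` {..<p} :: 'a set)"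
    using card_poly_roots_bound[OF P0] deg by (simp add: card_image of_nat_inj)
  ultimately have "of_nat ` {..<p} = {y. poly P y = 0}"
    by (intro card_seteq) (auto intro: poly_roots_finite P0)
  moreover have "tr x \<in> {y. poly P y = 0}"
    using root tr_power_p by simp
  ultimately show ?thesis by (metis (no_types, lifting) imageE)
qed

section \<open>Roots of unity and the trace character\<close>

lemma omega_pow_p: "omega p ^ p = 1"
proof -
  have "p > 0" using prime_p prime_gt_0_nat by blast
  then show ?thesis
    by (simp add: omega_def exp_of_nat_mult[symmetric])
qed

lemma omega_pow_mod: "omega p ^ (k mod p) = omega p ^ k"
proof -
  have "omega p ^ (p * (k div p) + k mod p) = omega p ^ (k mod p)"
    by (simp only: power_add power_mult omega_pow_p power_one mult_1)
  then show ?thesis by simp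
qed

text \<open>Two natural numbers that represent the same trace are congruent modulo \<open>p\<close>,
  so the choice made by \<open>LEAST\<close> does not affect the power of
  \<open>omega p\<close>.\<close>

lemma trace_char_eq:
  assumes "of_nat k = tr x"
  shows "ch x = omega p ^ k"
proof -
  have "of_nat (LEAST k. of_nat k = tr x) = tr x"
    by (rule LeastI) (rule assms)
  then have "(LEAST k. of_nat k = tr x) mod p = k mod p"
    using assms CHAR_p of_nat_eq_iff_cong_CHAR[where 'a='a] by (metis cong_def)
  then show ?thesis
    unfolding trace_char_def by (metis omega_pow_mod)
qed

lemma trace_char_add: "ch (x + y) = ch x * ch y"
proof -
  obtain k l where "of_nat k = tr x" "of_nat l = tr y"
    using tr_of_nat by metis
  moreover from this have "of_nat (k + l) = tr (x + y)"
    by (simp add: tr_add)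
  ultimately show ?thesis
    by (metis trace_char_eq power_add)
qed

lemma trace_char_0: "ch 0 = 1"
proof -
  have "of_nat 0 = tr 0"
    using prime_p prime_gt_0_nat by (simp add: field_trace_def power_0_left)
  then show ?thesis using trace_char_eq by fastforce
qed

lemma omega_pow_neq_1:
  assumes "0 < k" "k < p"
  shows "omega p ^ k \<noteq> 1"
proof
  assume "omega p ^ k = 1"
  then have "exp (of_nat k * (2 * of_real pi * \<i> / of_nat p)) = 1"
    unfolding omega_def by (subst exp_of_nat_mult)
  then obtain m :: int where "real k * (2 * pi) / real p = 2 * of_int m * pi"
    using assms by (auto simp: exp_eq_1)
  then have "real k = of_int m * real p"
    using assms by (simp add: field_simps)
  then have "int k = m * int p"
    by (metis of_int_eq_iff of_int_mult of_int_of_nat_eq)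
  then have "p dvd k"
    by (metis dvd_triv_right int_dvd_int_iff)
  then show False
    using assms by (simp add: nat_dvd_not_less)
qed

text \<open>The trace is given by a nonzero polynomial of degree at most \<open>p ^ (r - 1)\<close>,
  which is less than the size of the field, so some \<open>y\<close> has nonzero trace. The witness
  is then \<open>y / x\<close>.\<close>

lemma trace_char_nontrivial:
  assumes "x \<noteq> 0"
  obtains c where "ch (c * x) \<noteq> 1"
proof -
  define P :: "'a poly" where "P = (\<Sum>i<r. monom 1 (p ^ i))"
  have p1: "p > 1" using prime_p prime_gt_1_nat by blast
  have "degree P \<le> p ^ (r - 1)"
    unfolding P_def using p1
    by (intro degree_sum_le) (auto intro!: order.trans[OF degree_monom_le] power_increasing)
  also have "\<dots> < p ^ r"
    using p1 r_pos by (intro power_strict_increasing) auto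
  finally have deg: "degree P < CARD('a)" using card_field by simp
  \<comment> \<open>The exponent \<open>p ^ i\<close> equals 1 only for \<open>i = 0\<close>, so the
    linear coefficient is 1 and \<open>P\<close> is not zero.\<close>
  have "coeff P 1 = (\<Sum>i<r. if i = 0 then 1 else 0)"
    unfolding P_def coeff_sum using p1 by (intro sum.cong) auto
  then have "P \<noteq> 0" using r_pos by auto
  then have "{y. poly P y = 0} \<noteq> UNIV"
    using card_poly_roots_bound[of P] deg by auto
  then obtain y where y: "poly P y \<noteq> 0" by auto
  have "tr y \<noteq> 0"
    using y by (simp add: P_def field_trace_def poly_sum poly_monom)
  obtain k where k: "of_nat k = tr y" using tr_of_nat by metis
  have kp: "of_nat (k mod p) = tr y"
    using k CHAR_p of_nat_eq_iff_cong_CHAR[where 'a='a, of "k mod p" k]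
    by (simp add: cong_def)
  have "ch y \<noteq> 1"
    using trace_char_eq[OF kp] omega_pow_neq_1[of "k mod p"] kp \<open>tr y \<noteq> 0\<close> p1
    by (cases "k mod p = 0") auto
  then show thesis
    using that[of "y / x"] assms by simp
qed

lemma trace_char_sum: "ch (\<Sum>i\<in>I. g i) = (\<Prod>i\<in>I. ch (g i))"
  by (induction I rule: infinite_finite_induct) (auto simp: trace_char_0 trace_char_add)

end

section \<open>Duality for linear codes\<close>

definition dotp :: "'a::comm_semiring_1 ^ 'm::finite \<Rightarrow> 'a ^ 'm \<Rightarrow> 'a" where
  "dotp x y = (\<Sum>i\<in>UNIV. x $ i * y $ i)"

definition perp :: "('a::comm_semiring_1 ^ 'm::finite) set \<Rightarrow> ('a ^ 'm) set" where
  "perp A = {x. \<forall>y\<in>A. dotp x y = 0}"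

lemma dotp_commute: "dotp x y = dotp y x"
  by (simp add: dotp_def mult.commute)

lemma dotp_add_right: "dotp x (y + z) = dotp x y + dotp x z"
  by (simp add: dotp_def distrib_left sum.distrib)

lemma dotp_add_left: "dotp (x + y) z = dotp x z + dotp y z"
  by (simp add: dotp_def distrib_right sum.distrib)

lemma dotp_scale_right: "dotp x (c *s y) = c * dotp x y"
  by (simp add: dotp_def sum_distrib_left mult.left_commute)

lemma dotp_scale_left: "dotp (c *s x) y = c * dotp x y"
  by (simp add: dotp_def sum_distrib_left mult.assoc)

lemma dotp_0_right [simp]: "dotp x 0 = 0"
  by (simp add: dotp_def)

lemma dotp_0_left [simp]: "dotp 0 x = 0"
  by (simp add: dotp_def)

lemma subspace_perp: "vec.subspace (perp (A :: ('a::field ^ 'm::finite) set))"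
  by (rule vec.subspaceI)
    (auto simp: perp_def dotp_add_left dotp_scale_left)

section \<open>Error operators, and characters on subspaces\<close>

context finite_field_trace
begin

text \<open>One coordinate with \<open>v $ i \<noteq> u $ i + a $ i\<close> kills the product over
  the tensor factors; otherwise the characters multiply to the character of a sum.\<close>

lemma error_op_nth:
  "error_op p r c a b $ v $ u = (if v = u + a then omega p ^ c * ch (dotp b u) else 0)"
  for a :: "'a ^ 'm::finite"
proof -
  have 1: "(shift_X x ** phase_Z p r y) $ s $ t = (if s = t + x then ch (y * t) else 0)"
    for x y s t :: 'a
    by (simp add: matrix_matrix_mult_def shift_X_def phase_Z_def if_distrib[of "\<lambda>z. _ * z"] cong: if_cong)
  have "tensor_op (\<lambda>i. shift_X (a $ i) ** phase_Z p r (b $ i)) $ v $ u =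
      (if v = u + a then ch (dotp b u) else 0)"
    by (auto simp: tensor_op_def 1 vec_eq_iff dotp_def trace_char_sum intro!: prod_zero)
  then show ?thesis
    by (simp add: error_op_def map_matrix_def)
qed

text \<open>The phase is the cost of moving \<open>Z(b)\<close> past \<open>X(a')\<close>. Comparing
  both orders of multiplication yields the commutation relation of two errors.\<close>

lemma error_op_mult:
  "error_op p r c a b ** error_op p r c' a' b' =
     map_matrix ((*) (ch (dotp b a'))) (error_op p r (c + c') (a + a') (b + b'))"
  for a :: "'a ^ 'm::finite"
proof -
  have "(error_op p r c a b ** error_op p r c' a' b') $ v $ u =
      ch (dotp b a') * error_op p r (c + c') (a + a') (b + b') $ v $ u" for v u
  proof -
    have "(error_op p r c a b ** error_op p r c' a' b') $ v $ u =
        (\<Sum>w\<in>UNIV. if w = u + a' then error_op p r c a b $ v $ (u + a') * (omega p ^ c' * ch (dotp b' u)) else 0)"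
      by (simp only: matrix_matrix_mult_def vec_lambda_beta error_op_nth[of c'])
        (rule sum.cong, auto)
    also have "\<dots> = error_op p r c a b $ v $ (u + a') * (omega p ^ c' * ch (dotp b' u))"
      by simp
    also have "\<dots> = ch (dotp b a') * error_op p r (c + c') (a + a') (b + b') $ v $ u"
      by (simp add: error_op_nth add.assoc add.commute[of a] dotp_add_right dotp_add_left
          trace_char_add power_add)
    finally show ?thesis .
  qed
  then show ?thesis
    by (simp add: vec_eq_iff map_matrix_def)
qed

lemma error_op_0_0: "error_op p r c (0 :: 'a ^ 'm::finite) 0 = map_matrix ((*) (omega p ^ c)) (mat 1)"
  by (auto simp: vec_eq_iff error_op_nth map_matrix_def mat_def trace_char_0)

lemma error_op_mult_vec:
  "(error_op p r c a b *v x) $ v = omega p ^ c * ch (dotp b (v - a)) * x $ (v - a)"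
  for a :: "'a ^ 'm::finite"
proof -
  have "(error_op p r c a b *v x) $ v =
    (\<Sum>w\<in>UNIV. if w = v - a then omega p ^ c * ch (dotp b (v - a)) * x $ (v - a) else 0)"
    unfolding matrix_vector_mult_def
    by (auto simp: error_op_nth eq_diff_eq intro!: sum.cong)
  then show ?thesis by simp
qed

text \<open>Scaling \<open>y\<close> inside the subspace lets the inner product run through the
  whole field, so the annihilator with respect to the character is no larger than
  \<open>perp\<close>, which is defined without the trace.\<close>

lemma subspace_nontrivial_char:
  assumes "vec.subspace A" "x \<notin> perp A"
  obtains y :: "'a ^ 'm::finite" where "y \<in> A" "ch (dotp x y) \<noteq> 1"
proof -
  obtain y where y: "y \<in> A" "dotp x y \<noteq> 0"
    using assms by (auto simp: perp_def)
  obtain c where "ch (c * dotp x y) \<noteq> 1"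
    using trace_char_nontrivial[OF y(2)] .
  then show thesis
    using that[of "c *s y"] vec.subspace_scale[OF assms(1) y(1)] by (simp add: dotp_scale_right)
qed

text \<open>Orthogonality of characters: translating the summation by a suitable \<open>z\<close>
  multiplies the sum by a factor other than 1, so the sum vanishes.\<close>

lemma sum_trace_char_subspace:
  fixes x :: "'a ^ 'm::finite"
  assumes "vec.subspace A"
  shows "(\<Sum>y\<in>A. ch (dotp x y)) = (if x \<in> perp A then of_nat (card A) else 0)"
proof (cases "x \<in> perp A")
  case True
  then show ?thesis by (simp add: perp_def trace_char_0)
next
  case False
  then obtain z where z: "z \<in> A" "ch (dotp x z) \<noteq> 1"
    using subspace_nontrivial_char[OF assms] by metis
  have "(\<Sum>y\<in>A. ch (dotp x y)) = (\<Sum>y\<in>A. ch (dotp x (z + y)))"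
    by (rule sum.reindex_bij_witness[of _ "\<lambda>y. z + y" "\<lambda>y. y - z"])
      (use assms z in \<open>auto intro: vec.subspace_add vec.subspace_diff\<close>)
  also have "\<dots> = ch (dotp x z) * (\<Sum>y\<in>A. ch (dotp x y))"
    by (simp add: dotp_add_right trace_char_add sum_distrib_left)
  finally show ?thesis
    using False z by simp
qed

text \<open>Double counting of the sum of \<open>ch (dotp x y)\<close> over all \<open>x\<close> and
  all \<open>y \<in> A\<close>: summing over \<open>A\<close> first selects
  \<open>x \<in> perp A\<close>, summing over the whole space first selects
  \<open>y = 0\<close>.\<close>

lemma card_perp:
  assumes "vec.subspace (A :: ('a ^ 'm::finite) set)"
  shows "card (perp A) * card A = CARD('a ^ 'm)"
proof -
  have perp_UNIV: "x \<in> perp UNIV \<longleftrightarrow> x = 0" for x :: "'a ^ 'm"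
  proof
    assume x: "x \<in> perp UNIV"
    have "x $ j = 0" for j
    proof -
      have "dotp x (axis j 1) = x $ j"
        by (simp add: dotp_def axis_def if_distrib[of "\<lambda>z. _ * z"] cong: if_cong)
      then show ?thesis using x by (auto simp: perp_def)
    qed
    then show "x = 0" by (simp add: vec_eq_iff)
  qed (auto simp: perp_def)
  have "(of_nat (card (perp A) * card A) :: complex) = (\<Sum>x\<in>UNIV. \<Sum>y\<in>A. ch (dotp x y))"
    by (simp add: sum_trace_char_subspace[OF assms] sum.If_cases)
  also have "\<dots> = (\<Sum>y\<in>A. \<Sum>x\<in>UNIV. ch (dotp y x))"
    by (subst sum.swap) (simp add: dotp_commute)
  also have "\<dots> = (\<Sum>y\<in>A. if y = 0 then of_nat (CARD('a ^ 'm)) else 0)"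
    by (subst sum_trace_char_subspace) (auto simp: perp_UNIV)
  also have "\<dots> = of_nat (CARD('a ^ 'm))"
    using assms vec.subspace_0 by auto
  finally show ?thesis
    by (rule of_nat_eq_iff[THEN iffD1])
qed

text \<open>One inclusion is immediate, and applying \<open>card_perp\<close> twice shows that the
  cardinalities agree.\<close>

lemma perp_perp:
  assumes "vec.subspace (A :: ('a ^ 'm::finite) set)"
  shows "perp (perp A) = A"
proof -
  have "A \<subseteq> perp (perp A)"
    by (auto simp: perp_def dotp_commute)
  moreover have "card (perp (perp A)) * card (perp A) = card A * card (perp A)"
    using card_perp[OF assms] card_perp[OF subspace_perp[of A]] by (simp add: mult.commute)
  moreover have "card (perp A) > 0"
    using card_perp[OF assms] by (metis mult_is_0 neq0_conv zero_less_card_finite)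
  ultimately show ?thesis
    by (intro card_seteq[symmetric]) auto
qed

end

lemma map_matrix_scale_mult_left:
  "map_matrix ((*) s) A ** B = map_matrix ((*) s) (A ** B)" for s :: "'a::comm_semiring_1"
  by (simp add: vec_eq_iff map_matrix_def matrix_matrix_mult_def sum_distrib_left mult.assoc)

lemma map_matrix_scale_mult_right:
  "A ** map_matrix ((*) s) B = map_matrix ((*) s) (A ** B)" for s :: "'a::comm_semiring_1"
  by (simp add: vec_eq_iff map_matrix_def matrix_matrix_mult_def sum_distrib_left mult.left_commute)

section \<open>CSS codes\<close>

locale css_code = finite_field_trace p r F
  for p r :: nat and F :: "'a::{field,finite} itself" +
  fixes Q :: "('a ^ 'm::finite) set"
  assumes subspace_Q: "vec.subspace Q" and perp_subset: "perp Q \<subseteq> Q"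
begin

text \<open>Phases other than \<open>c = 0\<close> never arise: \<open>perp Q\<close> is orthogonal
  to \<open>Q\<close>, hence to itself, so products of these operators pick up only the phase 1. The
  code is the eigenspace of the trivial character.\<close>

definition S :: "('a ^ 'm) cmat set" where
  "S = {error_op p r 0 a b | a b. a \<in> perp Q \<and> b \<in> perp Q}"

definition C :: "('a ^ 'm) cvec set" where
  "C = {v. \<forall>E\<in>S. E *v v = v}"

text \<open>This is the average of the elements of \<open>S\<close>: averaging the shifts averages
  over cosets of \<open>perp Q\<close>, and averaging the phases restricts to
  \<open>Q\<close>.\<close>

definition P :: "('a ^ 'm) cmat" where
  "P = (\<chi> v u. if v \<in> Q \<and> v - u \<in> perp Q then 1 / of_nat (card (perp Q)) else 0)"

section \<open>The stabilizer group\<close>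

lemma S_mult: 
  assumes "a \<in> perp Q" "b \<in> perp Q" "a' \<in> perp Q" "b' \<in> perp Q"
  shows "error_op p r 0 a b ** error_op p r 0 a' b' = error_op p r 0 (a + a') (b + b')"
proof -
  have "dotp b a' = 0" using assms perp_subset by (auto simp: perp_def)
  then show ?thesis
    by (simp add: error_op_mult trace_char_0 map_matrix_def vec_eq_iff)
qed

lemma subgroup_S: "subgroup S (error_group p r)"
proof
  have 0: "error_op p r 0 (0 :: 'a ^ 'm) 0 = mat 1"
    by (simp add: error_op_0_0 map_matrix_def vec_eq_iff)
  show "S \<subseteq> carrier (error_group p r)"
    using prime_p prime_gt_0_nat by (auto simp: S_def error_group_def)
  show "x \<otimes>\<^bsub>error_group p r\<^esub> y \<in> S" if xy: "x \<in> S" "y \<in> S" for x y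
  proof -
    obtain a b a' b' where "x = error_op p r 0 a b" "y = error_op p r 0 a' b'"
      and "a \<in> perp Q" "b \<in> perp Q" "a' \<in> perp Q" "b' \<in> perp Q"
      using xy unfolding S_def by blast
    then show ?thesis
      using S_mult[of a b a' b'] vec.subspace_add[OF subspace_perp[of Q]]
      by (auto simp: S_def error_group_def)
  qed
  show "\<one>\<^bsub>error_group p r\<^esub> \<in> S"
    using 0 vec.subspace_0[OF subspace_perp[of Q]] by (auto simp: S_def error_group_def intro!: exI[of _ 0])
  show "inv\<^bsub>error_group p r\<^esub> x \<in> S" if x_S: "x \<in> S" for x
  proof -
    obtain a b where x: "x = error_op p r 0 a b" "a \<in> perp Q" "b \<in> perp Q"
      using x_S unfolding S_def by blast
    define y where "y = error_op p r 0 (- a) (- b)"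
    have m: "- a \<in> perp Q" "- b \<in> perp Q"
      using x vec.subspace_neg[OF subspace_perp[of Q]] by auto
    have xy: "x ** y = mat 1" "y ** x = mat 1"
      using x m 0 S_mult[of a b "- a" "- b"] S_mult[of "- a" "- b" a b] by (simp_all add: y_def)
    have "inv\<^bsub>error_group p r\<^esub> x = y"
      \<comment> \<open>The inverse is a definite description over the carrier, so existence and
        uniqueness are checked directly; uniqueness cancels \<open>x\<close> by multiplying with
        \<open>y\<close> on the left.\<close>
      unfolding m_inv_def
    proof (rule the_equality)
      show "y \<in> carrier (error_group p r) \<and> x \<otimes>\<^bsub>error_group p r\<^esub> y = \<one>\<^bsub>error_group p r\<^esub>
        \<and> y \<otimes>\<^bsub>error_group p r\<^esub> x = \<one>\<^bsub>error_group p r\<^esub>"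
        using xy prime_p prime_gt_0_nat by (auto simp: error_group_def y_def)
      show "z = y" if "z \<in> carrier (error_group p r) \<and> x \<otimes>\<^bsub>error_group p r\<^esub> z = \<one>\<^bsub>error_group p r\<^esub>
        \<and> z \<otimes>\<^bsub>error_group p r\<^esub> x = \<one>\<^bsub>error_group p r\<^esub>" for z
      proof -
        have "x ** z = mat 1" using that by (simp add: error_group_def)
        then have "y ** (x ** z) = y" by simp
        then show ?thesis using xy by (simp add: matrix_mul_assoc)
      qed
    qed
    then show ?thesis
      using m by (auto simp: S_def y_def)
  qed
qed

lemma S_commute: "E \<in> S \<Longrightarrow> E' \<in> S \<Longrightarrow> E ** E' = E' ** E"
proof -
  assume "E \<in> S" "E' \<in> S"
  then obtain a b a' b' where "E = error_op p r 0 a b" "E' = error_op p r 0 a' b'"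
    and "a \<in> perp Q" "b \<in> perp Q" "a' \<in> perp Q" "b' \<in> perp Q"
    unfolding S_def by blast
  then show ?thesis
    by (simp only: S_mult add.commute)
qed

section \<open>The projector and its range\<close>

lemma translate_perp_iff:
  assumes "a \<in> perp Q"
  shows "v + a \<in> Q \<longleftrightarrow> v \<in> Q" "v - a \<in> Q \<longleftrightarrow> v \<in> Q"
    "u - (v + a) \<in> perp Q \<longleftrightarrow> u - v \<in> perp Q" "v - a - u \<in> perp Q \<longleftrightarrow> v - u \<in> perp Q"
proof -
  have *: "x + a \<in> A \<longleftrightarrow> x \<in> A" "x - a \<in> A \<longleftrightarrow> x \<in> A" if "vec.subspace A" "a \<in> A" for x A
  proof -
    show "x + a \<in> A \<longleftrightarrow> x \<in> A"
    proof
      assume "x + a \<in> A"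
      then show "x \<in> A" using vec.subspace_diff[OF that(1) _ that(2), of "x + a"] by simp
    qed (rule vec.subspace_add[OF that(1) _ that(2)])
    show "x - a \<in> A \<longleftrightarrow> x \<in> A"
    proof
      assume "x - a \<in> A"
      then show "x \<in> A" using vec.subspace_add[OF that(1) _ that(2), of "x - a"] by simp
    qed (rule vec.subspace_diff[OF that(1) _ that(2)])
  qed
  show "v + a \<in> Q \<longleftrightarrow> v \<in> Q" "v - a \<in> Q \<longleftrightarrow> v \<in> Q"
    using * subspace_Q assms perp_subset by auto
  show "u - (v + a) \<in> perp Q \<longleftrightarrow> u - v \<in> perp Q"
    "v - a - u \<in> perp Q \<longleftrightarrow> v - u \<in> perp Q"
    using *(2)[OF subspace_perp assms, of "u - v"]
      *(2)[OF subspace_perp assms, of "v - u"] by (simp_all add: algebra_simps)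
qed

lemma dotp_perp_Q: "b \<in> perp Q \<Longrightarrow> v \<in> Q \<Longrightarrow> dotp b v = 0"
  by (simp add: perp_def)

lemma mem_Q_cong:
  assumes "v - u \<in> perp Q"
  shows "v \<in> Q \<longleftrightarrow> u \<in> Q"
  using translate_perp_iff(1)[OF assms, of u] by simp

lemma minus_perp_iff: "v - u \<in> perp Q \<longleftrightarrow> u - v \<in> perp Q"
  using vec.subspace_neg[OF subspace_perp[of Q], of "v - u"] vec.subspace_neg[OF subspace_perp[of Q], of "u - v"]
  by auto

text \<open>The operator moves rows within a coset of \<open>perp Q\<close>, and its phase is 1 on
  \<open>Q\<close>, where the nonzero rows of \<open>P\<close> lie.\<close>

lemma stabilizer_mult_projector:
  assumes "a \<in> perp Q" "b \<in> perp Q"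
  shows "error_op p r 0 a b ** P = P"
proof -
  have "(error_op p r 0 a b ** P) $ v $ u = P $ v $ u" for v u
  proof -
    have "(error_op p r 0 a b ** P) $ v $ u =
      (\<Sum>w\<in>UNIV. if w = v - a then ch (dotp b (v - a)) * P $ (v - a) $ u else 0)"
      by (simp only: matrix_matrix_mult_def vec_lambda_beta error_op_nth)
        (rule sum.cong, auto simp: eq_diff_eq)
    also have "\<dots> = ch (dotp b (v - a)) * P $ (v - a) $ u"
      by simp
    also have "\<dots> = P $ v $ u"
      using translate_perp_iff(2,4)[OF assms(1)] dotp_perp_Q[OF assms(2)] by (simp add: P_def trace_char_0)
    finally show ?thesis .
  qed
  then show ?thesis by (simp add: vec_eq_iff)
qed

lemma projector_mult_stabilizer:
  assumes "a \<in> perp Q" "b \<in> perp Q"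
  shows "P ** error_op p r 0 a b = P"
proof -
  have "(P ** error_op p r 0 a b) $ v $ u = P $ v $ u" for v u
  proof -
    have "(P ** error_op p r 0 a b) $ v $ u =
      (\<Sum>w\<in>UNIV. if w = u + a then P $ v $ (u + a) * ch (dotp b u) else 0)"
      by (simp only: matrix_matrix_mult_def vec_lambda_beta error_op_nth)
        (rule sum.cong, auto)
    also have "\<dots> = P $ v $ (u + a) * ch (dotp b u)"
      by simp
    also have "\<dots> = P $ v $ u"
      using translate_perp_iff(3)[OF assms(1), of v u] dotp_perp_Q[OF assms(2), of u] mem_Q_cong[of v u]
      by (auto simp: P_def trace_char_0)
    finally show ?thesis .
  qed
  then show ?thesis by (simp add: vec_eq_iff)
qed

lemma card_perp_pos: "card (perp Q) > 0"
  using vec.subspace_0[OF subspace_perp[of Q]] by (auto simp: card_gt_0_iff)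

lemma card_perp_translate: "card {w. v - w \<in> perp Q} = card (perp Q)"
  by (rule bij_betw_same_card[of "\<lambda>w. v - w"])
    (auto intro!: bij_betw_byWitness[where f' = "\<lambda>w. v - w"])

text \<open>Stabilizer elements with \<open>b = 0\<close> give invariance under translations. Those
  with \<open>a = 0\<close> force the support into \<open>perp (perp Q)\<close>, which is
  \<open>Q\<close>.\<close>

lemma code_nth:
  assumes "v \<in> C"
  shows "a \<in> perp Q \<Longrightarrow> v $ (u - a) = v $ u" "u \<notin> Q \<Longrightarrow> v $ u = 0"
proof -
  have 1: "ch (dotp b (u - a)) * v $ (u - a) = v $ u" if "a \<in> perp Q" "b \<in> perp Q" for a b u
    using assms that error_op_mult_vec[of 0 a b v u] by (force simp: C_def S_def)
  have 0: "0 \<in> perp Q" using vec.subspace_0[OF subspace_perp] .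
  show "v $ (u - a) = v $ u" if "a \<in> perp Q"
    using 1[OF that 0, of u] by (simp add: trace_char_0)
  show "v $ u = 0" if "u \<notin> Q"
  proof -
    have "u \<notin> perp (perp Q)" using that perp_perp[OF subspace_Q] by simp
    then obtain b where "b \<in> perp Q" "ch (dotp u b) \<noteq> 1"
      using subspace_nontrivial_char[OF subspace_perp] by metis
    then show ?thesis
      using 1[OF 0, of b u] by (simp add: dotp_commute)
  qed
qed

text \<open>A code vector is constant on cosets of \<open>perp Q\<close>, so averaging over a coset
  returns its value; outside \<open>Q\<close> both sides vanish.\<close>

lemma projector_fixes_code: 
  assumes "v \<in> C"
  shows "P *v v = v"
proof -
  have "(P *v v) $ u = v $ u" for u
  proof (cases "u \<in> Q")
    case True
    have "(P *v v) $ u = (\<Sum>w\<in>UNIV. if u - w \<in> perp Q then v $ u / of_nat (card (perp Q)) else 0)"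
      unfolding matrix_vector_mult_def vec_lambda_beta
    proof (rule sum.cong[OF refl])
      show "P $ u $ w * v $ w = (if u - w \<in> perp Q then v $ u / of_nat (card (perp Q)) else 0)" for w
        using True code_nth(1)[OF assms, of "u - w" u] by (auto simp: P_def)
    qed
    also have "\<dots> = v $ u"
      using card_perp_pos by (auto simp: sum.If_cases card_perp_translate)
    finally show ?thesis .
  next
    case False
    then show ?thesis
      using code_nth(2)[OF assms] by (simp add: matrix_vector_mult_def P_def)
  qed
  then show ?thesis by (simp add: vec_eq_iff)
qed

lemma projector_in_code: "P *v x \<in> C"
  by (auto simp: C_def S_def matrix_vector_mul_assoc stabilizer_mult_projector)

lemma range_projector: "range ((*v) P) = C"
proof
  show "C \<subseteq> range ((*v) P)"
  proof
    fix v assume "v \<in> C"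
    then show "v \<in> range ((*v) P)"
      using projector_fixes_code[of v] rangeI[of "(*v) P" v] by simp
  qed
qed (use projector_in_code in auto)

lemma projector_idem: "P ** P = P"
proof -
  have "(P ** P) *v x = P *v x" for x
    unfolding matrix_vector_mul_assoc[symmetric] by (rule projector_fixes_code[OF projector_in_code])
  then show ?thesis by (metis matrix_eq)
qed

lemma orth_projector_P: "orth_projector P C"
proof -
  have "map_matrix cnj (transpose P) = P"
  proof -
    have "v \<in> Q \<and> v - u \<in> perp Q \<longleftrightarrow> u \<in> Q \<and> u - v \<in> perp Q" for u v
      using mem_Q_cong[of v u] minus_perp_iff[of v u] by blast
    then show ?thesis
      by (simp add: vec_eq_iff map_matrix_def transpose_def P_def)
  qed
  then show ?thesis
    by (simp add: orth_projector_def range_projector projector_idem)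
qed

section \<open>The dimension of the code\<close>

lemma column_P_nth:
  "u \<in> Q \<Longrightarrow> column u P $ v = (if v - u \<in> perp Q then 1 / of_nat (card (perp Q)) else 0)"
  using mem_Q_cong[of v u] by (cases "v - u \<in> perp Q") (simp_all add: column_def P_def)

text \<open>For an index in \<open>Q\<close>, a column is a normalised indicator function of the
  coset of that index, so evaluation at \<open>u\<close> decides equality.\<close>

lemma column_P_eq_iff:
  assumes "u \<in> Q" "w \<in> Q"
  shows "column u P = column w P \<longleftrightarrow> u - w \<in> perp Q"
proof
  assume "column u P = column w P"
  then have "column w P $ u = column u P $ u" by simp
  then show "u - w \<in> perp Q"
    using assms card_perp_pos vec.subspace_0[OF subspace_perp, of Q]
    by (auto simp: column_P_nth split: if_splits)
next
  assume "u - w \<in> perp Q"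
  then have "v - u \<in> perp Q \<longleftrightarrow> v - w \<in> perp Q" for v
    using translate_perp_iff(3)[of "u - w" v w] by simp
  then show "column u P = column w P"
    using assms by (simp add: vec_eq_iff column_P_nth)
qed

abbreviation "B \<equiv> (\<lambda>u. column u P) ` Q"

text \<open>Distinct columns are supported on disjoint cosets, so evaluating a linear relation at
  one point of a coset isolates one coefficient.\<close>

lemma independent_columns: "vec.independent B"
proof -
  have "c b = 0" if "b \<in> B" "(\<Sum>b\<in>B. c b *s b) = 0" for c b
  proof -
    obtain u where u: "b = column u P" "u \<in> Q" using \<open>b \<in> B\<close> by auto
    have "0 = (\<Sum>b\<in>B. c b *s b) $ u" using that by simp
    also have "\<dots> = (\<Sum>b'\<in>B. if b' = b then c b / of_nat (card (perp Q)) else 0)"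
      unfolding sum_component
    proof (rule sum.cong[OF refl])
      fix b' assume "b' \<in> B"
      then obtain w where w: "b' = column w P" "w \<in> Q" by auto
      show "(c b' *s b') $ u = (if b' = b then c b / of_nat (card (perp Q)) else 0)"
        using u w column_P_eq_iff[OF u(2) w(2)] vec.subspace_0[OF subspace_perp, of Q]
        by (auto simp: column_P_nth)
    qed
    also have "\<dots> = c b / of_nat (card (perp Q))"
      using that by simp
    finally show ?thesis using card_perp_pos by auto
  qed
  then show ?thesis
    using vec.dependent_finite[of B] by auto
qed

lemma dim_code: "vec.dim C = card B"
proof (rule vec.basis_card_eq_dim[symmetric])
  show "B \<subseteq> C"
  proof (rule image_subsetI)
    fix u
    have "(P *v axis u 1) $ i = column u P $ i" for i
      by (simp add: matrix_vector_mult_def column_def axis_def if_distrib[of "\<lambda>z. _ * z"] cong: if_cong)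
    then have "P *v axis u 1 = column u P"
      by (subst vec_eq_iff) blast
    then show "column u P \<in> C"
      using projector_in_code[of "axis u 1"] by simp
  qed
  show "vec.independent B" by (rule independent_columns)
  show "C \<subseteq> vec.span B"
  proof
    fix v assume "v \<in> C"
    \<comment> \<open>The projection expands the vector in the columns of \<open>P\<close>; the
      columns outside \<open>Q\<close> drop out because \<open>v\<close> vanishes there.\<close>
    then have "v = P *v v" by (rule projector_fixes_code[symmetric])
    also have "\<dots> = (\<Sum>u\<in>UNIV. (v $ u) *s column u P)"
      by (rule matrix_mult_sum)
    also have "\<dots> = (\<Sum>u\<in>Q. (v $ u) *s column u P)"
      using code_nth(2)[OF \<open>v \<in> C\<close>] by (intro sum.mono_neutral_right) auto
    also have "\<dots> \<in> vec.span B"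
      by (intro vec.span_sum vec.span_scale vec.span_base imageI)
    finally show "v \<in> vec.span B" .
  qed
qed

text \<open>The fibres of the map from \<open>Q\<close> to the columns are the cosets of
  \<open>perp Q\<close>.\<close>

lemma card_columns: "card B * card (perp Q) = card Q"
proof -
  have "card Q = (\<Sum>b\<in>B. card {u \<in> Q. column u P = b})"
    using sum.image_gen[of Q "\<lambda>_. 1::nat" "\<lambda>u. column u P"] by simp
  also have "\<dots> = (\<Sum>b\<in>B. card (perp Q))"
  proof (rule sum.cong[OF refl])
    fix b assume "b \<in> B"
    then obtain w where w: "b = column w P" "w \<in> Q" by auto
    have "{u \<in> Q. column u P = b} = {u. w - u \<in> perp Q}"
    proof -
      have "u \<in> Q \<and> column u P = b \<longleftrightarrow> w - u \<in> perp Q" for u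
        using w column_P_eq_iff[of u w] minus_perp_iff[of u w] mem_Q_cong[of w u] by blast
      then show ?thesis by blast
    qed
    then show "card {u \<in> Q. column u P = b} = card (perp Q)"
      by (simp add: card_perp_translate)
  qed
  finally show ?thesis by simp
qed

lemma stabilizer_code_C: "stabilizer_code p r C"
  unfolding stabilizer_code_def
proof (intro conjI exI[of _ S] exI[of _ "\<lambda>_. 1"])
  \<comment> \<open>The column at \<open>0 \<in> Q\<close> belongs to the basis, so the eigenspace
    is nonzero.\<close>
  have "card B > 0"
    using vec.subspace_0[OF subspace_Q] by (auto simp: card_gt_0_iff)
  then show "C \<noteq> {0}"
    using dim_code vec.dim_eq_0[of C] by auto
qed (use subgroup_S S_commute in \<open>auto simp: C_def\<close>)

section \<open>Detection of errors and the parameters\<close>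

lemma detectable:
  assumes d: "\<And>x. x \<in> Q \<Longrightarrow> x \<noteq> 0 \<Longrightarrow> d \<le> enat (card {i. x $ i \<noteq> 0})"
    and w: "enat (error_weight a b) < d"
  shows "\<exists>s. P ** error_op p r c a b ** P = map_matrix ((*) s) P"
proof -
  let ?E = "error_op p r c a b"
  \<comment> \<open>Since \<open>P\<close> absorbs stabilizer elements on both sides, one may be
    inserted before or after the error. This gives two multiples of the same matrix
    \<open>P ** ?G ** P\<close> with different phases, so that matrix is zero.\<close>
  have zero: "P ** ?E ** P = map_matrix ((*) 0) P"
    if st: "s \<in> perp Q" "t \<in> perp Q" and ne: "ch (dotp t a) \<noteq> ch (dotp b s)" for s t
  proof -
    let ?W = "error_op p r 0 s t" and ?G = "error_op p r c (a + s) (b + t)"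
    have "map_matrix ((*) (ch (dotp t a))) (P ** ?G ** P) = P ** (?W ** ?E) ** P"
      by (simp add: error_op_mult add.commute map_matrix_scale_mult_left map_matrix_scale_mult_right)
    also have "\<dots> = P ** ?E ** P"
      using projector_mult_stabilizer[OF st] by (simp add: matrix_mul_assoc)
    also have "\<dots> = P ** (?E ** ?W) ** P"
      using stabilizer_mult_projector[OF st] by (simp add: matrix_mul_assoc[symmetric])
    also have "\<dots> = map_matrix ((*) (ch (dotp b s))) (P ** ?G ** P)"
      by (simp add: error_op_mult map_matrix_scale_mult_left map_matrix_scale_mult_right)
    finally have 1: "map_matrix ((*) (ch (dotp t a))) (P ** ?G ** P) =
      map_matrix ((*) (ch (dotp b s))) (P ** ?G ** P)" .
    have "P ** ?G ** P = 0"
      using 1 ne by (simp add: vec_eq_iff map_matrix_def)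
    moreover have "P ** ?E ** P = map_matrix ((*) (ch (dotp b s))) (P ** ?G ** P)"
      using \<open>P ** ?E ** P = P ** (?E ** ?W) ** P\<close>
        \<open>P ** (?E ** ?W) ** P = map_matrix ((*) (ch (dotp b s))) (P ** ?G ** P)\<close> by simp
    ultimately show ?thesis
      by (simp add: vec_eq_iff map_matrix_def)
  qed
  have 0: "0 \<in> perp Q" using vec.subspace_0[OF subspace_perp] .
  consider "a \<notin> Q" | "b \<notin> Q" | "a \<in> Q" "b \<in> Q" by blast
  then show ?thesis
  proof cases
    case 1
    then obtain t where "t \<in> perp Q" "ch (dotp a t) \<noteq> 1"
      using subspace_nontrivial_char[OF subspace_perp] perp_perp[OF subspace_Q] by metis
    then show ?thesis
      using zero[OF 0, of t] by (auto simp: dotp_commute trace_char_0)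
  next
    case 2
    then obtain s where "s \<in> perp Q" "ch (dotp b s) \<noteq> 1"
      using subspace_nontrivial_char[OF subspace_perp] perp_perp[OF subspace_Q] by metis
    then show ?thesis
      using zero[OF _ 0, of s] by (metis dotp_0_left trace_char_0)
  next
    case 3
    \<comment> \<open>The weights of \<open>a\<close> and \<open>b\<close> are at most the weight of
      the error, hence below the distance of \<open>Q\<close>. Both vectors vanish, and only a
      scalar remains.\<close>
    have *: "card {i. a $ i \<noteq> 0} \<le> error_weight a b" "card {i. b $ i \<noteq> 0} \<le> error_weight a b"
      unfolding error_weight_def by (auto intro!: card_mono)
    then have "\<not> d \<le> enat (card {i. a $ i \<noteq> 0})" "\<not> d \<le> enat (card {i. b $ i \<noteq> 0})"
      using w by (meson enat_ord_simps(1) leD order_trans)+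
    then have "a = 0" "b = 0"
      using d 3 by auto
    then show ?thesis
      by (auto simp: error_op_0_0 map_matrix_scale_mult_left map_matrix_scale_mult_right projector_idem)
  qed
qed

text \<open>With \<open>N = CARD('m)\<close>, eliminating \<open>card (perp Q)\<close> from
  \<open>card B * card (perp Q) = q ^ K\<close> and \<open>card (perp Q) * q ^ K = q ^ N\<close>
  leaves \<open>card B = q ^ (2 * K) / q ^ N\<close>.\<close>

lemma has_parameters_C:
  assumes "card Q = CARD('a) ^ K"
    and "\<And>x. x \<in> Q \<Longrightarrow> x \<noteq> 0 \<Longrightarrow> d \<le> enat (card {i. x $ i \<noteq> 0})"
  shows "has_parameters p r C CARD('m) (2 * int K - int CARD('m)) d"
proof -
  let ?q = "real CARD('a)" and ?N = "CARD('m)"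
  have q: "?q \<noteq> 0" by simp
  have "real (card B) * real (card (perp Q)) = ?q ^ K"
    using card_columns assms(1) by (metis of_nat_mult of_nat_power)
  moreover have "real (card (perp Q)) * ?q ^ K = ?q ^ ?N"
    using card_perp[OF subspace_Q] assms(1) by (metis of_nat_mult of_nat_power CARD_vec)
  ultimately have "real (card B) * ?q ^ ?N = ?q ^ (2 * K)"
    by (metis mult.assoc mult_2 power_add)
  then have "real (card B) = ?q ^ (2 * K) / ?q ^ ?N"
    using q by (simp add: nonzero_eq_divide_eq)
  also have "\<dots> = ?q powi (2 * int K - int ?N)"
    using q by (simp add: power_int_diff flip: power_int_of_nat)
  finally show ?thesis
    unfolding has_parameters_def
    using dim_code orth_projector_P detectable[OF assms(2)] by auto
qed

end

section \<open>Quasi-cyclic codes\<close>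

lemma degree_cyc_modulus: "n \<ge> 1 \<Longrightarrow> degree (cyc_modulus n :: 'a::field poly) = n"
  unfolding cyc_modulus_def diff_conv_add_uminus
  by (subst degree_add_eq_left) (auto simp: degree_monom_eq)

lemma cyc_modulus_nonzero: "n \<ge> 1 \<Longrightarrow> cyc_modulus n \<noteq> (0 :: 'a::field poly)"
  using degree_cyc_modulus[of n, where 'a='a] by auto

lemma degree_mod_cyc_modulus: "n \<ge> 1 \<Longrightarrow> degree (a mod cyc_modulus n :: 'a::field poly) < n"
  using degree_mod_less'[of "cyc_modulus n" a] degree_cyc_modulus[of n, where 'a='a]
    cyc_modulus_nonzero[of n, where 'a='a]
  by (cases "a mod cyc_modulus n = 0") auto

lemma length_residue_vec [simp]: "length (residue_vec n a) = n"
  by (simp add: residue_vec_def)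

lemma nth_residue_vec: "i < n \<Longrightarrow> residue_vec n a ! i = coeff (a mod cyc_modulus n) i"
  by (simp add: residue_vec_def)

lemma residue_vec_eq_iff:
  fixes a b :: "'a::field poly"
  assumes "n \<ge> 1"
  shows "residue_vec n a = residue_vec n b \<longleftrightarrow> cyc_modulus n dvd a - b"
proof -
  have "residue_vec n a = residue_vec n b \<longleftrightarrow> a mod cyc_modulus n = b mod cyc_modulus n"
  proof
    assume *: "residue_vec n a = residue_vec n b"
    show "a mod cyc_modulus n = b mod cyc_modulus n"
    proof (rule poly_eqI)
      fix i
      show "coeff (a mod cyc_modulus n) i = coeff (b mod cyc_modulus n) i"
      proof (cases "i < n")
        case True
        then show ?thesis
          using arg_cong[OF *, of "\<lambda>v. v ! i"] by (simp add: nth_residue_vec)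
      next
        case False
        then show ?thesis
          using degree_mod_cyc_modulus[OF assms, of a] degree_mod_cyc_modulus[OF assms, of b]
          by (simp add: coeff_eq_0)
      qed
    qed
  qed (simp add: residue_vec_def)
  then show ?thesis by (simp add: mod_eq_dvd_iff)
qed

lemma residue_vec_eq_0_iff:
  fixes a :: "'a::field poly"
  assumes "n \<ge> 1"
  shows "residue_vec n a = replicate n 0 \<longleftrightarrow> cyc_modulus n dvd a"
proof -
  have "replicate n 0 = residue_vec n (0 :: 'a poly)"
    by (auto simp: residue_vec_def intro!: nth_equalityI)
  then show ?thesis
    using residue_vec_eq_iff[OF assms, of a 0] by simp
qed

lemma residue_vec_of_degree_less:
  fixes a :: "'a::field poly"
  assumes "degree a < n"
  shows "residue_vec n a = map (coeff a) [0..<n]"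
  using assms degree_cyc_modulus[of n, where 'a='a] by (simp add: residue_vec_def mod_poly_less)

lemma residue_vec_Poly:
  fixes v :: "'a::field list"
  assumes "length v = n" "n \<ge> 1"
  shows "residue_vec n (Poly v) = v"
proof -
  have "degree (Poly v) < n"
    using assms by (intro degree_lessI) (auto simp: nth_default_def)
  then show ?thesis
    using assms by (auto simp: residue_vec_of_degree_less nth_default_def intro!: nth_equalityI)
qed

text \<open>The quotients of \<open>u\<close> by \<open>f\<close> and of \<open>v - h * u\<close> by
  \<open>g\<close> serve as the module coefficients, so that later arguments deal with divisibility
  only.\<close>

lemma quasi_cyclic_code_eq:
  "quasi_cyclic_code n f g h =
     {residue_vec n u @ residue_vec n v | u v. f dvd u \<and> g dvd v - h * u}"
proof (intro equalityI subsetI)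
  fix w assume "w \<in> quasi_cyclic_code n f g h"
  then obtain c e where "w = residue_vec n (c * f) @ residue_vec n (c * (h * f) + e * g)"
    by (auto simp: quasi_cyclic_code_def)
  moreover have "g dvd c * (h * f) + e * g - h * (c * f)"
    by (simp add: algebra_simps)
  ultimately show "w \<in> {residue_vec n u @ residue_vec n v | u v. f dvd u \<and> g dvd v - h * u}"
    using dvd_triv_right by blast
next
  fix w assume "w \<in> {residue_vec n u @ residue_vec n v | u v. f dvd u \<and> g dvd v - h * u}"
  then obtain u v where w: "w = residue_vec n u @ residue_vec n v" "f dvd u" "g dvd v - h * u"
    by auto
  from w(2) obtain c where c: "u = c * f" by (metis dvdE mult.commute)
  from w(3) obtain e where e: "v - h * u = e * g" by (metis dvdE mult.commute)
  have "v = c * (h * f) + e * g"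
    using e c by (simp add: algebra_simps)
  then show "w \<in> quasi_cyclic_code n f g h"
    using w(1) c by (auto simp: quasi_cyclic_code_def)
qed

text \<open>As \<open>f\<close> and \<open>g\<close> divide the modulus, the two divisibility
  conditions do not depend on the chosen representatives.\<close>

lemma quasi_cyclic_code_iff:
  fixes f g h :: "'a::field poly"
  assumes "n \<ge> 1" "f dvd cyc_modulus n" "g dvd cyc_modulus n"
  shows "residue_vec n u @ residue_vec n v \<in> quasi_cyclic_code n f g h \<longleftrightarrow> f dvd u \<and> g dvd v - h * u"
proof
  assume "residue_vec n u @ residue_vec n v \<in> quasi_cyclic_code n f g h"
  then obtain u' v' where *: "residue_vec n u = residue_vec n u'" "residue_vec n v = residue_vec n v'"
    "f dvd u'" "g dvd v' - h * u'"
    by (auto simp: quasi_cyclic_code_eq)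
  then have d: "cyc_modulus n dvd u - u'" "cyc_modulus n dvd v - v'"
    using residue_vec_eq_iff[OF assms(1)] by blast+
  have "f dvd (u - u') + u'"
    using dvd_trans[OF assms(2) d(1)] *(3) by (rule dvd_add)
  moreover have "g dvd (v - v') - h * (u - u') + (v' - h * u')"
    using dvd_trans[OF assms(3) d(1)] dvd_trans[OF assms(3) d(2)] *(4)
    by (intro dvd_add[OF dvd_diff[OF _ dvd_mult]])
  ultimately show "f dvd u \<and> g dvd v - h * u"
    by (simp add: algebra_simps)
qed (auto simp: quasi_cyclic_code_eq)

section \<open>The inner product as a coefficient, and the dual code\<close>

lemma coeff_mod_cyc_modulus:
  fixes a :: "'a::field poly"
  assumes "degree a < 2 * n - 1"
  shows "coeff (a mod cyc_modulus n) (n - 1) = coeff a (n - 1)"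
proof -
  have n: "n \<ge> 1" using assms by simp
  \<comment> \<open>Reduction replaces \<open>lo + x^n hi\<close> by \<open>lo + hi\<close>. The
    degree bound \<open>2 * n - 1\<close> is just strong enough that \<open>hi\<close> has no
    coefficient at position \<open>n - 1\<close>.\<close>
  define lo where "lo = poly_cutoff n a"
  define hi where "hi = poly_shift n a"
  have "a = lo + monom 1 n * hi"
    by (rule poly_eqI) (auto simp: lo_def hi_def coeff_poly_cutoff coeff_poly_shift coeff_monom_mult)
  then have "a = cyc_modulus n * hi + (lo + hi)"
    by (simp add: cyc_modulus_def algebra_simps)
  then have "a mod cyc_modulus n = (lo + hi) mod cyc_modulus n"
    by (metis mod_mult_self4)
  moreover have deg: "coeff (lo + hi) i = 0" if "i \<ge> n" for i
    using that assms by (auto simp: lo_def hi_def coeff_poly_cutoff coeff_poly_shift intro: coeff_eq_0)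
  then have "degree (lo + hi) < n"
    using n by (intro degree_lessI) auto
  ultimately have "a mod cyc_modulus n = lo + hi"
    using degree_cyc_modulus[OF n, where 'a='a] by (simp add: mod_poly_less)
  moreover have "coeff hi (n - 1) = 0" 
    using assms n by (auto simp: hi_def coeff_poly_shift intro!: coeff_eq_0)
  ultimately show ?thesis
    using n by (simp add: lo_def coeff_poly_cutoff)
qed

text \<open>Reversal turns the inner product into a convolution read at position
  \<open>n - 1\<close>. Once \<open>b\<close> is reduced, the product has degree at most
  \<open>2 * n - 2\<close>, so reduction leaves this position unchanged.\<close>

lemma inner_residue_vec:
  fixes b :: "'a::field poly"
  assumes "length v = n" "n \<ge> 1"
  shows "sum_list (map2 (*) v (residue_vec n b)) =
    coeff ((Poly (rev v) * b) mod cyc_modulus n) (n - 1)"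
proof -
  let ?w = "b mod cyc_modulus n"
  have degR: "degree (Poly (rev v)) \<le> n - 1"
    using assms by (intro degree_le) (auto simp: nth_default_def)
  have "degree (Poly (rev v) * ?w) \<le> (n - 1) + degree ?w"
    using degree_mult_le[of "Poly (rev v)" ?w] degR by simp
  then have deg: "degree (Poly (rev v) * ?w) < 2 * n - 1"
    using degree_mod_cyc_modulus[OF assms(2), of b] by linarith
  have "coeff ((Poly (rev v) * b) mod cyc_modulus n) (n - 1) =
      coeff ((Poly (rev v) * ?w) mod cyc_modulus n) (n - 1)"
    by (simp add: mod_mult_right_eq)
  also have "\<dots> = coeff (Poly (rev v) * ?w) (n - 1)"
    by (rule coeff_mod_cyc_modulus[OF deg])
  also have "\<dots> = (\<Sum>i\<le>n - 1. coeff (Poly (rev v)) i * coeff ?w (n - 1 - i))"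
    by (simp add: coeff_mult)
  also have "\<dots> = (\<Sum>i<n. v ! i * coeff ?w i)"
    by (rule sum.reindex_bij_witness[of _ "\<lambda>i. n - 1 - i" "\<lambda>i. n - 1 - i"])
      (use assms in \<open>auto simp: nth_default_def rev_nth\<close>)
  also have "\<dots> = sum_list (map2 (*) v (residue_vec n b))"
    using assms by (auto simp: sum_list_sum_nth atLeast0LessThan nth_residue_vec intro!: sum.cong)
  finally show ?thesis by simp
qed

text \<open>Multiplication by \<open>x^(n - 1 - i)\<close> moves the coefficient at \<open>i\<close>
  of the reduced polynomial to position \<open>n - 1\<close>, and nothing wraps around onto
  it.\<close>

lemma cyc_modulus_dvdI:
  fixes w :: "'a::field poly"
  assumes "n \<ge> 1" "\<And>j. coeff ((monom 1 j * w) mod cyc_modulus n) (n - 1) = 0"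
  shows "cyc_modulus n dvd w"
proof -
  let ?w = "w mod cyc_modulus n"
  have "coeff ?w i = 0" if "i < n" for i
  proof -
    have "degree (monom 1 (n - 1 - i) * ?w) \<le> (n - 1 - i) + degree ?w"
      using degree_mult_le[of "monom 1 (n - 1 - i)" ?w] by (simp add: degree_monom_eq)
    then have deg: "degree (monom 1 (n - 1 - i) * ?w) < 2 * n - 1"
      using degree_mod_cyc_modulus[OF assms(1), of w] by linarith
    have "0 = coeff ((monom 1 (n - 1 - i) * ?w) mod cyc_modulus n) (n - 1)"
      using assms(2)[of "n - 1 - i"] by (simp add: mod_mult_right_eq)
    also have "\<dots> = coeff (monom 1 (n - 1 - i) * ?w) (n - 1)"
      by (rule coeff_mod_cyc_modulus[OF deg])
    also have "\<dots> = coeff ?w i"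
      using that by (simp add: coeff_monom_mult)
    finally show ?thesis by simp
  qed
  then have "?w = 0"
    using degree_mod_cyc_modulus[OF assms(1), of w] by (metis leading_coeff_0_iff)
  then show ?thesis by (simp add: dvd_eq_mod_eq_0)
qed

text \<open>\<open>rev\<close> reverses within the length of the list, \<open>reflect_poly\<close>
  about the actual degree. The two differ by a power of \<open>x\<close>, whose exponent counts the
  zeros at the start of \<open>v\<close>.\<close>

lemma reflect_poly_dvd:
  fixes v :: "'a::field list"
  shows "reflect_poly (Poly (rev v)) dvd Poly v"
proof (cases "Poly (rev v) = 0")
  case True
  then have "Poly v = 0" by (metis Poly_eq_0 rev_replicate rev_rev_ident)
  then show ?thesis by simp
next
  case False
  let ?R = "Poly (rev v)" and ?n = "length v"
  have n: "?n \<ge> 1" using False by (cases v) auto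
  have degR: "degree ?R \<le> ?n - 1"
    by (intro degree_le) (auto simp: nth_default_def)
  have cR: "coeff ?R (?n - 1 - i) = coeff (Poly v) i" if "i < ?n" for i
    using that by (simp add: nth_default_def rev_nth)
  have "Poly v = monom 1 (?n - 1 - degree ?R) * reflect_poly ?R"
  proof (rule poly_eqI)
    fix i
    show "coeff (Poly v) i = coeff (monom 1 (?n - 1 - degree ?R) * reflect_poly ?R) i"
    proof (cases "i < ?n")
      case True
      show ?thesis
        using True degR by (subst cR[symmetric, OF True])
          (auto simp: coeff_monom_mult coeff_reflect_poly coeff_eq_0 simp del: coeff_Poly_eq
            intro!: arg_cong[where f = "coeff ?R"])
    next
      case False
      then have "\<not> i < ?n - 1 - degree ?R" "i - (?n - 1 - degree ?R) > degree ?R"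
        using degR n by linarith+
      then show ?thesis
        using False by (simp add: coeff_monom_mult coeff_reflect_poly nth_default_def)
    qed
  qed
  then show ?thesis by simp
qed

text \<open>Cancelling \<open>g\<close> leaves \<open>cyc_modulus n div g\<close> as a divisor of
  the reversed polynomial, and reflection is multiplicative.\<close>

lemma perp_poly_dvd:
  fixes g :: "'a::field poly"
  assumes n: "n \<ge> 1" and "g dvd cyc_modulus n" "cyc_modulus n dvd Poly (rev v) * g"
  shows "perp_poly n g dvd Poly v"
proof -
  have "g \<noteq> 0" using assms(2) cyc_modulus_nonzero[OF n] by auto
  have "cyc_modulus n div g * g dvd Poly (rev v) * g"
    using assms by simp
  then have "cyc_modulus n div g dvd Poly (rev v)"
    using \<open>g \<noteq> 0\<close> by simp
  then obtain k where "Poly (rev v) = cyc_modulus n div g * k" ..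
  then have "perp_poly n g dvd reflect_poly (Poly (rev v))"
    by (simp add: perp_poly_def reflect_poly_mult)
  then show ?thesis
    using reflect_poly_dvd dvd_trans by blast
qed

lemma euclidean_dual_quasi_cyclic_code:
  fixes f g h :: "'a::field poly"
  assumes n: "n \<ge> 1" and f: "f dvd cyc_modulus n" and g: "g dvd cyc_modulus n"
    and fg: "f dvd g" and gp: "g dvd perp_poly n g"
  shows "euclidean_dual (2 * n) (quasi_cyclic_code n f g h) \<subseteq> quasi_cyclic_code n f g h"
proof
  fix z assume z: "z \<in> euclidean_dual (2 * n) (quasi_cyclic_code n f g h)"
  define u where "u = take n z"
  define v where "v = drop n z"
  have len: "length u = n" "length v = n" and zuv: "z = u @ v"
    using z by (auto simp: euclidean_dual_def u_def v_def)
  let ?U = "Poly (rev u)" and ?V = "Poly (rev v)" and ?M = "cyc_modulus n"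
  have inner: "coeff ((?U * a + ?V * b) mod ?M) (n - 1) = 0" if "f dvd a" "g dvd b - h * a" for a b
  proof -
    have "residue_vec n a @ residue_vec n b \<in> quasi_cyclic_code n f g h"
      using that by (auto simp: quasi_cyclic_code_eq)
    then have "sum_list (map2 (*) (u @ v) (residue_vec n a @ residue_vec n b)) = 0"
      using z zuv by (simp add: euclidean_dual_def)
    then show ?thesis
      using len n by (simp add: inner_residue_vec poly_mod_add_left)
  qed
  have V: "?M dvd ?V * g"
  proof (rule cyc_modulus_dvdI[OF n])
    show "coeff ((monom 1 j * (?V * g)) mod ?M) (n - 1) = 0" for j
      \<comment> \<open>The test word is \<open>x^j\<close> times the generator
        \<open>(0, g)\<close>.\<close>
      using inner[of 0 "monom 1 j * g"] by (simp add: mult_ac)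
  qed
  have UV: "?M dvd (?U + ?V * h) * f"
  proof (rule cyc_modulus_dvdI[OF n])
    show "coeff ((monom 1 j * ((?U + ?V * h) * f)) mod ?M) (n - 1) = 0" for j
      \<comment> \<open>The test word is \<open>x^j\<close> times the generator
        \<open>(f, h f)\<close>.\<close>
      using inner[of "monom 1 j * f" "h * (monom 1 j * f)"] by (simp add: algebra_simps)
  qed
  \<comment> \<open>Passing from \<open>f\<close> to its multiple \<open>g\<close> makes the
    relation comparable with \<open>V\<close>, so the term with \<open>?V\<close> can be
    subtracted.\<close>
  have "?M dvd (?U + ?V * h) * g"
    using UV fg by (meson dvd_trans dvd_refl mult_dvd_mono)
  then have "?M dvd (?U + ?V * h) * g - h * (?V * g)"
    using V by (meson dvd_diff dvd_mult)
  then have U: "?M dvd ?U * g"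
    by (simp add: algebra_simps)
  have "g dvd Poly u" "g dvd Poly v"
    using gp perp_poly_dvd[OF n g U] perp_poly_dvd[OF n g V] dvd_trans by blast+
  then have "f dvd Poly u" "g dvd Poly v - h * Poly u"
    using fg dvd_trans by (blast, simp)
  then have "residue_vec n (Poly u) @ residue_vec n (Poly v) \<in> quasi_cyclic_code n f g h"
    by (auto simp: quasi_cyclic_code_eq)
  then show "z \<in> quasi_cyclic_code n f g h"
    using len n by (simp add: residue_vec_Poly zuv)
qed

section \<open>The number of codewords\<close>

lemma card_degree_less:
  assumes "m \<ge> 1"
  shows "card {a :: 'a::{field,finite} poly. degree a < m} = CARD('a) ^ m"
proof -
  have "bij_betw (\<lambda>a. map (coeff a) [0..<m]) {a :: 'a poly. degree a < m} {xs. set xs \<subseteq> UNIV \<and> length xs = m}"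
  proof (rule bij_betw_byWitness[where f' = Poly])
    show "\<forall>a\<in>{a :: 'a poly. degree a < m}. Poly (map (coeff a) [0..<m]) = a"
      by (auto intro!: poly_eqI simp: nth_default_def coeff_eq_0)
    show "\<forall>xs\<in>{xs :: 'a list. set xs \<subseteq> UNIV \<and> length xs = m}. map (coeff (Poly xs)) [0..<m] = xs"
      by (auto simp: nth_default_def intro!: nth_equalityI)
    show "Poly ` {xs :: 'a list. set xs \<subseteq> UNIV \<and> length xs = m} \<subseteq> {a. degree a < m}"
      \<comment> \<open>The zero polynomial has degree 0, which is below \<open>m\<close> only
        because \<open>m \<ge> 1\<close>.\<close>
      using assms by (auto intro!: degree_lessI simp: nth_default_def)
  qed auto
  then show ?thesis
    using card_lists_length_eq[of "UNIV :: 'a set" m] by (simp add: bij_betw_same_card)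
qed

text \<open>The coefficients \<open>c\<close> and \<open>e\<close> matter only modulo
  \<open>?M div f\<close> and \<open>?M div g\<close>, and their reduced representatives are
  determined by the codeword.\<close>

lemma card_quasi_cyclic_code:
  fixes f g h :: "'a::{field,finite} poly"
  assumes n: "n \<ge> 1" and f: "f dvd cyc_modulus n" and g: "g dvd cyc_modulus n"
    and "degree f < n" "degree g < n"
  shows "card (quasi_cyclic_code n f g h) = CARD('a) ^ ((n - degree f) + (n - degree g))"
proof -
  let ?M = "cyc_modulus n :: 'a poly"
  let ?A = "{c :: 'a poly. degree c < n - degree f}" and ?B = "{c :: 'a poly. degree c < n - degree g}"
  let ?F = "\<lambda>(c, e). residue_vec n (c * f) @ residue_vec n (c * (h * f) + e * g)"
  have deg_div: "degree (?M div k) = n - degree k" and nz: "k \<noteq> 0" "?M div k \<noteq> 0"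
    if k: "k dvd ?M" for k
  proof -
    obtain l where l: "?M = k * l" using k by (rule dvdE)
    then have "k \<noteq> 0" "l \<noteq> 0" using cyc_modulus_nonzero[OF n, where 'a='a] by auto
    moreover from this have "n = degree k + degree l"
      using degree_cyc_modulus[OF n, where 'a='a] by (simp add: l degree_mult_eq)
    moreover from calculation(1) have "?M div k = l"
      unfolding l by simp
    ultimately show "degree (?M div k) = n - degree k" "k \<noteq> 0" "?M div k \<noteq> 0"
      by simp_all
  qed
  have inj: "c = c'" if "k dvd ?M" "degree c < n - degree k" "degree c' < n - degree k" "?M dvd (c - c') * k"
    for c c' k
  proof -
    have "?M div k * k dvd (c - c') * k" using that by simp
    then have "?M div k dvd c - c'" using nz[OF that(1)] by simp
    moreover have "degree (c - c') < degree (?M div k)"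
      using that by (simp add: deg_div degree_diff_less)
    ultimately show ?thesis
      using dvd_imp_degree_le[of "?M div k" "c - c'"] by fastforce
  qed
  have reduce: "\<exists>c'. degree c' < n - degree k \<and> ?M dvd (c - c') * k" if "k dvd ?M" "degree k < n" for c k
  proof (intro exI conjI)
    \<comment> \<open>A zero remainder has degree 0, which is admissible because
      \<open>degree k < n\<close>.\<close>
    show "degree (c mod (?M div k)) < n - degree k"
      using degree_mod_less'[of "?M div k" c] nz[OF that(1)] that deg_div[OF that(1)]
      by (cases "c mod (?M div k) = 0") auto
    have "c - c mod (?M div k) = ?M div k * (c div (?M div k))"
      by (simp add: minus_mod_eq_mult_div)
    then have "(c - c mod (?M div k)) * k = (?M div k * k) * (c div (?M div k))"
      by (simp add: mult_ac)
    also have "?M div k * k = ?M" using that by simp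
    finally show "?M dvd (c - c mod (?M div k)) * k" by simp
  qed
  have "inj_on ?F (?A \<times> ?B)"
  proof (rule inj_onI, clarify)
    fix c e c' e' :: "'a poly"
    assume deg: "degree c < n - degree f" "degree c' < n - degree f"
      "degree e < n - degree g" "degree e' < n - degree g"
    assume "residue_vec n (c * f) @ residue_vec n (c * (h * f) + e * g) =
      residue_vec n (c' * f) @ residue_vec n (c' * (h * f) + e' * g)"
    then have 1: "?M dvd c * f - c' * f" and 2: "?M dvd (c * (h * f) + e * g) - (c' * (h * f) + e' * g)"
      using residue_vec_eq_iff[OF n] by auto
    from 1 have c: "c = c'"
      using inj[OF f] deg by (simp add: left_diff_distrib)
    moreover from 2 c have "e = e'"
      using inj[OF g] deg by (simp add: left_diff_distrib)
    ultimately show "c = c' \<and> e = e'" by simp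
  qed
  moreover have "?F ` (?A \<times> ?B) = quasi_cyclic_code n f g h"
  proof (intro equalityI subsetI)
    fix z assume "z \<in> quasi_cyclic_code n f g h"
    then obtain c e where z: "z = residue_vec n (c * f) @ residue_vec n (c * (h * f) + e * g)"
      by (auto simp: quasi_cyclic_code_def)
    obtain c' where c': "degree c' < n - degree f" "?M dvd (c - c') * f"
      using reduce[OF f] assms by blast
    obtain e' where e': "degree e' < n - degree g" "?M dvd (e - e') * g"
      using reduce[OF g] assms by blast
    \<comment> \<open>Reducing \<open>c\<close> also alters the second component, but only by
      \<open>h\<close> times a multiple of the modulus.\<close>
    have "?M dvd h * ((c - c') * f) + (e - e') * g"
      by (rule dvd_add[OF dvd_mult[OF c'(2)] e'(2)])
    also have "h * ((c - c') * f) + (e - e') * g = (c * (h * f) + e * g) - (c' * (h * f) + e' * g)"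
      by (simp add: algebra_simps)
    finally have "z = ?F (c', e')"
      using z c' by (simp add: residue_vec_eq_iff[OF n] left_diff_distrib)
    then show "z \<in> ?F ` (?A \<times> ?B)"
      by (rule image_eqI) (simp add: c' e')
  next
    fix z assume "z \<in> ?F ` (?A \<times> ?B)"
    then obtain x where "z = ?F x"
      by (rule imageE)
    then have "z = residue_vec n (fst x * f) @ residue_vec n (fst x * (h * f) + snd x * g)"
      by (simp only: case_prod_beta)
    then show "z \<in> quasi_cyclic_code n f g h"
      unfolding quasi_cyclic_code_def by blast
  qed
  ultimately have "card (quasi_cyclic_code n f g h) = card (?A \<times> ?B)"
    using card_image by fastforce
  also have "\<dots> = CARD('a) ^ (n - degree f) * CARD('a) ^ (n - degree g)"
    using assms(4,5) by (simp add: card_cartesian_product card_degree_less)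
  finally show ?thesis
    by (simp only: power_add)
qed

section \<open>The distance bound\<close>

lemma cyclic_dist_le:
  fixes k w :: "'a::field poly"
  assumes "n \<ge> 1" "k dvd w" "\<not> cyc_modulus n dvd w"
  shows "cyclic_dist n k \<le> enat (hamming_weight (residue_vec n w))"
proof -
  obtain c where "w = c * k" using assms(2) by (metis dvdE mult.commute)
  then have "residue_vec n w \<in> cyclic_code n k - {replicate n 0}"
    using assms residue_vec_eq_0_iff[OF assms(1), of w] by (auto simp: cyclic_code_def)
  then show ?thesis
    unfolding cyclic_dist_def by (rule INF_lower)
qed

lemma hamming_weight_append: "hamming_weight (v @ w) = hamming_weight v + hamming_weight w"
  by (simp add: hamming_weight_def)

text \<open>The case split is on which of \<open>u\<close> and \<open>v\<close> vanish modulo the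
  modulus. In each case a nonvanishing component lies in a cyclic code whose distance enters the
  minimum; if both survive, the two weights add.\<close>

lemma dist_bound_le:
  fixes f g h :: "'a::field_gcd poly"
  assumes n: "n \<ge> 1" and f: "f dvd cyc_modulus n" and g: "g dvd cyc_modulus n"
    and mem: "f dvd u" "g dvd v - h * u"
    and nz: "\<not> (cyc_modulus n dvd u \<and> cyc_modulus n dvd v)"
  shows "dist_bound n f g h \<le> enat (hamming_weight (residue_vec n u @ residue_vec n v))"
proof -
  let ?M = "cyc_modulus n :: 'a poly"
  have *: "dist_bound n f g h \<le> x" if
    "x \<in> {cyclic_dist n g, cyclic_dist n (lcm f (g div gcd g h)), cyclic_dist n f + cyclic_dist n (gcd (h * f) g)}" for x
    unfolding dist_bound_def using that by (intro Min_le) auto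
  consider "?M dvd u" "\<not> ?M dvd v" | "\<not> ?M dvd u" "?M dvd v" | "\<not> ?M dvd u" "\<not> ?M dvd v"
    using nz by blast
  then show ?thesis
  proof cases
    case 1
    have "g dvd (v - h * u) + h * u"
      using mem(2) dvd_trans[OF g 1(1)] by (intro dvd_add[OF _ dvd_mult])
    then have "cyclic_dist n g \<le> enat (hamming_weight (residue_vec n v))"
      using cyclic_dist_le[OF n _ 1(2), of g] by simp
    also have "\<dots> \<le> enat (hamming_weight (residue_vec n u @ residue_vec n v))"
      by (simp add: hamming_weight_append)
    finally show ?thesis using *[of "cyclic_dist n g"] by auto
  next
    case 2
    \<comment> \<open>With \<open>v\<close> zero in \<open>R\<close>, \<open>g\<close> divides
      \<open>h * u\<close>; the cofactor of \<open>gcd g h\<close> in \<open>g\<close> is coprime to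
      that in \<open>h\<close>, so it divides \<open>u\<close>.\<close>
    have "g dvd v - (v - h * u)"
      using mem(2) dvd_trans[OF g 2(2)] by (rule dvd_diff[rotated])
    then have "g dvd u * h" by (simp add: mult.commute)
    have "g \<noteq> 0" using g cyc_modulus_nonzero[OF n] by auto
    then have "gcd g h \<noteq> 0" by simp
    have "g div gcd g h * gcd g h dvd (u * (h div gcd g h)) * gcd g h"
      using \<open>g dvd u * h\<close> by (simp add: mult.assoc)
    then have "g div gcd g h dvd u * (h div gcd g h)"
      using \<open>gcd g h \<noteq> 0\<close> by (simp only: dvd_mult_cancel_right) auto
    moreover have "coprime (g div gcd g h) (h div gcd g h)"
      using \<open>g \<noteq> 0\<close> by (intro div_gcd_coprime) auto
    ultimately have "g div gcd g h dvd u"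
      by (simp add: coprime_dvd_mult_left_iff)
    then have "lcm f (g div gcd g h) dvd u"
      using mem by simp
    then have "cyclic_dist n (lcm f (g div gcd g h)) \<le> enat (hamming_weight (residue_vec n u))"
      using cyclic_dist_le[OF n _ 2(1)] by blast
    also have "\<dots> \<le> enat (hamming_weight (residue_vec n u @ residue_vec n v))"
      by (simp add: hamming_weight_append)
    finally show ?thesis using *[of "cyclic_dist n (lcm f (g div gcd g h))"] by auto
  next
    case 3
    \<comment> \<open>The first summand is a multiple of \<open>g\<close>, the second of
      \<open>h * f\<close>.\<close>
    have "gcd (h * f) g dvd (v - h * u) + h * u"
    proof (rule dvd_add)
      show "gcd (h * f) g dvd v - h * u"
        using mem by (meson dvd_trans gcd_dvd2)
      show "gcd (h * f) g dvd h * u"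
        using mem by (meson dvd_trans gcd_dvd1 mult_dvd_mono dvd_refl)
    qed
    then have "cyclic_dist n (gcd (h * f) g) \<le> enat (hamming_weight (residue_vec n v))"
      using cyclic_dist_le[OF n _ 3(2)] by simp
    moreover have "cyclic_dist n f \<le> enat (hamming_weight (residue_vec n u))"
      using cyclic_dist_le[OF n mem(1) 3(1)] .
    ultimately have "cyclic_dist n f + cyclic_dist n (gcd (h * f) g) \<le>
      enat (hamming_weight (residue_vec n u)) + enat (hamming_weight (residue_vec n v))"
      by (intro add_mono)
    then show ?thesis
      using *[of "cyclic_dist n f + cyclic_dist n (gcd (h * f) g)"]
      by (auto simp: hamming_weight_append)
  qed
qed

section \<open>Transport from lists to vectors indexed by \<open>'m\<close>, and the resulting
  code\<close>

theorem theorem12: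
  fixes p r n :: nat
    and f g h :: "'a::{field_gcd,finite} poly"
  assumes "prime p" and "r \<ge> 1" and "CARD('a) = p ^ r"
    and "n \<ge> 1" and "CARD('m::finite) = 2 * n"
    and "lead_coeff f = 1" and "lead_coeff g = 1" and "lead_coeff h = 1"
    and "degree f < n" and "degree g < n" and "degree h < n"
    and "f dvd cyc_modulus n" and "g dvd cyc_modulus n"
    and "f dvd g" and "g dvd perp_poly n g" and "perp_poly n g dvd perp_poly n f"
  shows "euclidean_dual (2 * n) (quasi_cyclic_code n f g h) \<subseteq> quasi_cyclic_code n f g h
    \<and> (\<exists>C :: ('a ^ 'm) cvec set.
         stabilizer_code p r C \<and>
         has_parameters p r C (2 * n)
           (2 * int n - 2 * int (degree f) - 2 * int (degree g))
           (dist_bound n f g h))"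
proof -
  note n = \<open>n \<ge> 1\<close> and f = \<open>f dvd cyc_modulus n\<close> and g = \<open>g dvd cyc_modulus n\<close>
  let ?Q = "quasi_cyclic_code n f g h"
  have dual: "euclidean_dual (2 * n) ?Q \<subseteq> ?Q"
    using euclidean_dual_quasi_cyclic_code[OF n f g \<open>f dvd g\<close> \<open>g dvd perp_poly n g\<close>] .
  obtain \<phi> :: "nat \<Rightarrow> 'm" where \<phi>: "bij_betw \<phi> {..<2 * n} UNIV"
    using finite_same_card_bij[of "{..<2 * n}" "UNIV :: 'm set"] \<open>CARD('m) = 2 * n\<close> by auto
  \<comment> \<open>\<open>L\<close> lists the coordinates in the order given by \<phi>;
    \<open>U\<close> and \<open>V\<close> are the polynomials of the two halves of that
    list.\<close>
  define L :: "'a ^ 'm \<Rightarrow> 'a list" where "L x = map (\<lambda>i. x $ \<phi> i) [0..<2 * n]" for x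
  define U :: "'a ^ 'm \<Rightarrow> 'a poly" where "U x = (\<Sum>i<n. monom (x $ \<phi> i) i)" for x
  define V :: "'a ^ 'm \<Rightarrow> 'a poly" where "V x = (\<Sum>i<n. monom (x $ \<phi> (n + i)) i)" for x
  have coeff_sum_monom: "coeff (\<Sum>i<n. monom (c i) i) j = (if j < n then c j else 0)"
    for c :: "nat \<Rightarrow> 'a" and j
    by (simp add: coeff_sum)
  have residue_sum_monom: "residue_vec n (\<Sum>i<n. monom (c i) i) = map c [0..<n]"
    for c :: "nat \<Rightarrow> 'a"
  proof -
    have "degree (\<Sum>i<n. monom (c i) i) < n"
      using n by (intro degree_lessI) (auto simp: coeff_sum_monom)
    then show ?thesis
      by (simp add: residue_vec_of_degree_less coeff_sum_monom)
  qed
  have L_eq: "L x = residue_vec n (U x) @ residue_vec n (V x)" for x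
    unfolding U_def V_def residue_sum_monom L_def
    by (auto intro!: nth_equalityI simp: nth_append)
  have U_lin: "U (x + y) = U x + U y" "U (c *s x) = smult c (U x)"
    and V_lin: "V (x + y) = V x + V y" "V (c *s x) = smult c (V x)" and UV0: "U 0 = 0" "V 0 = 0" for x y c
    by (auto simp: U_def V_def coeff_sum_monom intro!: poly_eqI)
  have bij_L: "bij_betw L UNIV {xs. length xs = 2 * n}"
  proof (rule bij_betw_byWitness[where f' = "\<lambda>xs. \<chi> i. xs ! the_inv_into {..<2 * n} \<phi> i"])
    show "\<forall>x\<in>UNIV. (\<chi> i. L x ! the_inv_into {..<2 * n} \<phi> i) = x"
    proof
      fix x
      have "L x ! the_inv_into {..<2 * n} \<phi> i = x $ i" for i
        using f_the_inv_into_f_bij_betw[OF \<phi>, of i] bij_betwE[OF bij_betw_the_inv_into[OF \<phi>], rule_format, of i]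
        by (simp add: L_def)
      then show "(\<chi> i. L x ! the_inv_into {..<2 * n} \<phi> i) = x"
        by (simp add: vec_eq_iff)
    qed
    show "\<forall>xs\<in>{xs. length xs = 2 * n}. L (\<chi> i. xs ! the_inv_into {..<2 * n} \<phi> i) = xs"
      using \<phi> by (auto simp: L_def bij_betw_def the_inv_into_f_f intro!: nth_equalityI)
  qed (auto simp: L_def)
  define Q where "Q = {x. L x \<in> ?Q}"
  have Q_iff: "x \<in> Q \<longleftrightarrow> f dvd U x \<and> g dvd V x - h * U x" for x
    by (simp add: Q_def L_eq quasi_cyclic_code_iff[OF n f g])
  have dotp_L: "dotp x y = sum_list (map2 (*) (L x) (L y))" for x y
  proof -
    have "dotp x y = (\<Sum>i<2 * n. x $ \<phi> i * y $ \<phi> i)"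
      unfolding dotp_def by (rule sum.reindex_bij_betw[OF \<phi>, symmetric])
    then show ?thesis
      by (simp add: sum_list_sum_nth L_def atLeast0LessThan)
  qed
  have weight_L: "card {i. x $ i \<noteq> 0} = hamming_weight (L x)" for x
  proof -
    have "hamming_weight (L x) = card {i. i < 2 * n \<and> x $ \<phi> i \<noteq> 0}"
      unfolding hamming_weight_def length_filter_conv_card
      by (rule arg_cong[where f = card]) (auto simp: L_def)
    also have "\<dots> = card {i. x $ i \<noteq> 0}"
    proof (rule bij_betw_same_card)
      show "bij_betw \<phi> {i. i < 2 * n \<and> x $ \<phi> i \<noteq> 0} {i. x $ i \<noteq> 0}"
        by (rule bij_betw_subset[OF \<phi>]) (use \<phi> in \<open>auto simp: bij_betw_def\<close>)
    qed
    finally show ?thesis by simp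
  qed
  have image_L: "L ` Q = ?Q"
  proof
    show "?Q \<subseteq> L ` Q"
    proof
      fix z assume z: "z \<in> ?Q"
      then have "length z = 2 * n"
        by (auto simp: quasi_cyclic_code_def)
      then obtain x where "z = L x"
        using bij_betw_imp_surj_on[OF bij_L] by blast
      then show "z \<in> L ` Q" using z by (simp add: Q_def)
    qed
  qed (auto simp: Q_def)
  interpret css_code p r "TYPE('a)" Q
  proof unfold_locales
    show "prime p" "CARD('a) = p ^ r" by fact+
    \<comment> \<open>By \<open>Q_iff\<close> membership is a pair of divisibility conditions on
      expressions linear in the vector.\<close>
    show "vec.subspace Q"
    proof (rule vec.subspaceI)
      show "0 \<in> Q" by (simp add: Q_iff UV0)
      show "x + y \<in> Q" if "x \<in> Q" "y \<in> Q" for x y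
      proof -
        have "V (x + y) - h * U (x + y) = (V x - h * U x) + (V y - h * U y)"
          by (simp add: U_lin V_lin algebra_simps)
        then show ?thesis
          using that by (simp add: Q_iff U_lin dvd_add)
      qed
      show "c *s x \<in> Q" if "x \<in> Q" for c x
      proof -
        have "V (c *s x) - h * U (c *s x) = smult c (V x - h * U x)"
          by (simp add: U_lin V_lin smult_diff_right)
        then show ?thesis
          using that by (simp add: Q_iff U_lin dvd_smult)
      qed
    qed
    show "perp Q \<subseteq> Q"
    proof
      fix x assume "x \<in> perp Q"
      then have "L x \<in> euclidean_dual (2 * n) (L ` Q)"
        by (auto simp: perp_def euclidean_dual_def dotp_L) (simp add: L_def)
      then show "x \<in> Q"
        using dual unfolding image_L by (auto simp: Q_def)
    qed
  qed
  have "card Q = card ?Q"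
    using bij_L image_L by (metis bij_betw_def card_image inj_on_subset subset_UNIV)
  then have card_Q: "card Q = CARD('a) ^ ((n - degree f) + (n - degree g))"
    using card_quasi_cyclic_code[OF n f g \<open>degree f < n\<close> \<open>degree g < n\<close>, of h] by simp
  have dist: "dist_bound n f g h \<le> enat (card {i. x $ i \<noteq> 0})" if "x \<in> Q" "x \<noteq> 0" for x :: "'a ^ 'm"
  proof -
    \<comment> \<open>If both halves vanished modulo the modulus, \<open>x\<close> and
      \<open>0\<close> would have the same list, against injectivity of \<open>L\<close>.\<close>
    have "\<not> (cyc_modulus n dvd U x \<and> cyc_modulus n dvd V x)"
    proof
      assume *: "cyc_modulus n dvd U x \<and> cyc_modulus n dvd V x"
      then have "residue_vec n (U x) = residue_vec n (U 0)" "residue_vec n (V x) = residue_vec n (V 0)"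
        by (simp_all add: residue_vec_eq_iff[OF n] UV0)
      then have "L x = L 0" by (simp only: L_eq)
      then show False
        using bij_betw_imp_inj_on[OF bij_L] \<open>x \<noteq> 0\<close> by (auto dest: injD)
    qed
    then show ?thesis
      using dist_bound_le[OF n f g, of "U x" "V x" h] \<open>x \<in> Q\<close>
      by (simp add: weight_L L_eq Q_iff)
  qed
  \<comment> \<open>Here \<open>K = (n - degree f) + (n - degree g)\<close>, and
    \<open>2 * K - 2 * n\<close> is the claimed exponent; the degree bounds make the natural
    subtractions exact.\<close>
  have "has_parameters p r C (2 * n) (2 * int n - 2 * int (degree f) - 2 * int (degree g))
      (dist_bound n f g h)"
    using has_parameters_C[OF card_Q dist] \<open>CARD('m) = 2 * n\<close> \<open>degree f < n\<close> \<open>degree g < n\<close>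
    by (simp add: of_nat_diff algebra_simps)
  with dual stabilizer_code_C show ?thesis by blast
qed

end
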